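(* Let $\mathcal{B}$ be Bring's curve $\{\sum_{i=1}^5 x_i=\sum_{i=1}^5x_i^2=\sum_{i=1}^5x_i^3=0\}\subset\mathbb{P}^4$ over $\mathbb{C}$, and let $\alpha,\beta,\gamma$ be the roots of $x^3+2x^2+3x+4$. Let $W_{345}=[1:1:\alpha:\beta:\gamma]$ and define $$P_{345}=[\delta':\delta:A:B:1],\qquad P'_{345}=[\delta:\delta':A:B:1],$$ where $$A=\frac{(-43\alpha^2-113\alpha-92)\beta}{112}-\frac{13\alpha^2+27\alpha+20}{28},\qquad B=\frac{(43\alpha^2+25\alpha-4)\beta}{112}+\frac{13\alpha^2+3\alpha-24}{28},$$ and $\delta,\delta'$ are the roots of $$x^2-\left[\frac{(11\alpha+12)\beta+4(3\alpha+2)}{14}\right]x+\left[\frac{23(155\alpha+388)\beta+92(97\alpha+172)}{6272}\right].$$ Define $W_{ijk},P_{ijk},P'_{ijk}$ similarly for distinct $i,j,k$ (see context). Then there is a holomorphic differential $\nu_{345}$ on $\mathcal{B}$ with divisor $$4W_{345}+P_{345}+P'_{345},$$ and a meromorphic function on $\mathcal{B}$ with divisor $$P_{145}+P'_{145}+P_{245}+P'_{245}-4W_{345}.$$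
   Context: $\mathcal{B}$ is a smooth curve of genus $4$. For distinct $i,j,k\in\{1,\dots,5\}$, $W_{ijk}$ is the point of $\mathcal{B}$ with $x_i=\alpha$, $x_j=\beta$, $x_k=\gamma$ and the other two coordinates equal to $1$; these 60 points are the Weierstrass points of $\mathcal{B}$. Similarly, $P_{ijk}$ and $P'_{ijk}$ are the two points with $i$-th, $j$-th, $k$-th coordinates equal to $A$, $B$, $1$ respectively and with the remaining two coordinates equal to $\delta',\delta$ in the two possible orders. *)

theory Defs
  imports "HOL-Complex_Analysis.Complex_Analysis" "HOL-Library.Numeral_Type"
    "HOL-Library.Poly_Mapping"
begin

section \<open>Functions and differentials relative to a complex atlas\<close>

text \<open>A chart is a pair \<open>(U, z)\<close> of an open subset of the surface and a coordinate \<open>z\<close>, of which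
  only the values on \<open>U\<close> matter.\<close>

type_synonym 'a chart = "'a set \<times> ('a \<Rightarrow> complex)"

abbreviation chart_range :: "'a chart \<Rightarrow> complex set" where
  "chart_range c \<equiv> snd c ` fst c"

abbreviation chart_inv :: "'a chart \<Rightarrow> complex \<Rightarrow> 'a" where
  "chart_inv c \<equiv> inv_into (fst c) (snd c)"

text \<open>A meromorphic function is totalised by the value 0 at its poles, as in
  \<^const>\<open>nicely_meromorphic_on\<close>; away from its poles it is a holomorphic function.\<close>

definition meromorphic_function :: "'a chart set \<Rightarrow> ('a \<Rightarrow> complex) \<Rightarrow> bool" where
  "meromorphic_function \<A> f \<longleftrightarrow>
     (\<forall>c\<in>\<A>. (f \<circ> chart_inv c) nicely_meromorphic_on chart_range c)"

text \<open>A differential is given by its coefficients: \<open>\<nu> c t\<close> stands for \<open>\<nu> = \<nu> c t dt\<close> in the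
  coordinate \<open>t\<close> of the chart \<open>c\<close>. The second condition is the transformation rule under
  the change of coordinates \<open>s = snd d (chart_inv c t)\<close>.\<close>

definition holomorphic_differential :: "'a chart set \<Rightarrow> ('a chart \<Rightarrow> complex \<Rightarrow> complex) \<Rightarrow> bool" where
  "holomorphic_differential \<A> \<nu> \<longleftrightarrow>
     (\<forall>c\<in>\<A>. \<nu> c holomorphic_on chart_range c) \<and>
     (\<forall>c\<in>\<A>. \<forall>d\<in>\<A>. \<forall>p\<in>fst c \<inter> fst d.
        \<nu> c (snd c p) = \<nu> d (snd d p) * deriv (snd d \<circ> chart_inv c) (snd c p))"

text \<open>A divisor is a finitely supported integer-valued function on the set \<open>X\<close> of points.
  The argument \<open>g\<close> is a family of local expressions, one for each chart. Its order at \<open>p\<close> is required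
  to be \<open>D(p)\<close> in some, and in every, chart around \<open>p\<close>. As \<^const>\<open>zorder\<close> is
  unspecified for functions that vanish near the point, these are excluded explicitly.\<close>

definition has_divisor ::
  "'a set \<Rightarrow> 'a chart set \<Rightarrow> ('a chart \<Rightarrow> complex \<Rightarrow> complex) \<Rightarrow> ('a \<Rightarrow>\<^sub>0 int) \<Rightarrow> bool" where
  "has_divisor X \<A> g D \<longleftrightarrow>
     Poly_Mapping.keys D \<subseteq> X \<and>
     (\<forall>p\<in>X. (\<exists>c\<in>\<A>. p \<in> fst c) \<and>
        (\<forall>c\<in>\<A>. p \<in> fst c \<longrightarrow>
           (\<exists>\<^sub>F t in at (snd c p). g c t \<noteq> 0) \<and>
           zorder (g c) (snd c p) = Poly_Mapping.lookup D p))"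

definition function_has_divisor ::
  "'a set \<Rightarrow> 'a chart set \<Rightarrow> ('a \<Rightarrow> complex) \<Rightarrow> ('a \<Rightarrow>\<^sub>0 int) \<Rightarrow> bool" where
  "function_has_divisor X \<A> f D \<longleftrightarrow> has_divisor X \<A> (\<lambda>c. f \<circ> chart_inv c) D"


section \<open>Complex projective space and smooth curves in it\<close>

text \<open>Points of projective space are the lines through the origin of \<open>complex ^ 'n\<close>,
  with the origin removed.\<close>

definition proj :: "complex ^ 'n \<Rightarrow> (complex ^ 'n) set" where
  "proj v = {c *s v | c. c \<noteq> 0}"

definition proj_space :: "(complex ^ 'n) set set" where
  "proj_space = proj ` {v. v \<noteq> 0}"

definition proj_topology :: "(complex ^ 'n) set topology" where
  "proj_topology = topology (\<lambda>S. S \<subseteq> proj_space \<and> open {v. v \<noteq> 0 \<and> proj v \<in> S})"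

lemma openin_proj_topology:
  "openin (proj_topology :: (complex ^ 'n) set topology) S \<longleftrightarrow>
     S \<subseteq> proj_space \<and> open {v. v \<noteq> 0 \<and> proj v \<in> S}"
proof -
  have "istopology (\<lambda>S :: (complex ^ 'n) set set.
          S \<subseteq> proj_space \<and> open {v. v \<noteq> 0 \<and> proj v \<in> S})"
    unfolding istopology_def
  proof (intro conjI allI impI; (elim conjE)?)
    fix S T :: "(complex ^ 'n) set set"
    assume "open {v. v \<noteq> 0 \<and> proj v \<in> S}" "open {v. v \<noteq> 0 \<and> proj v \<in> T}"
    then have "open ({v. v \<noteq> 0 \<and> proj v \<in> S} \<inter> {v. v \<noteq> 0 \<and> proj v \<in> T})"
      by (rule open_Int)
    then show "open {v. v \<noteq> 0 \<and> proj v \<in> S \<inter> T}"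
      by (rule back_subst[where P = "open"]) auto
  next
    fix \<K> :: "(complex ^ 'n) set set set"
    assume "\<forall>K\<in>\<K>. K \<subseteq> proj_space \<and> open {v. v \<noteq> 0 \<and> proj v \<in> K}"
    then have "open (\<Union>K\<in>\<K>. {v. v \<noteq> 0 \<and> proj v \<in> K})"
      by blast
    then show "open {v. v \<noteq> 0 \<and> proj v \<in> \<Union>\<K>}"
      by (rule back_subst[where P = "open"]) auto
  qed auto
  then show ?thesis
    unfolding proj_topology_def by (simp add: topology_inverse')
qed

text \<open>The charts of a smooth curve \<open>X\<close> in projective space, seen as a complex submanifold:
  homeomorphisms from open subsets of \<open>X\<close> to open subsets of the complex plane whose
  inverse is a holomorphic immersion \<open>t \<mapsto> [w(t)]\<close> into projective space; it is an immersion at \<open>t\<close> iff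
  \<open>w(t)\<close> and \<open>w'(t)\<close> are linearly independent, i.e. iff some 2 by 2 minor is nonzero.
  One global lift \<open>w\<close> is no restriction, as line bundles on open subsets of the plane are trivial.\<close>

definition curve_atlas :: "(complex ^ 'n) set set \<Rightarrow> (complex ^ 'n) set chart set" where
  "curve_atlas X = {c.
     openin (subtopology proj_topology X) (fst c) \<and>
     open (chart_range c) \<and>
     homeomorphic_map (subtopology proj_topology (fst c)) (top_of_set (chart_range c)) (snd c) \<and>
     (\<exists>w :: complex \<Rightarrow> complex ^ 'n.
        (\<forall>i. (\<lambda>t. w t $ i) holomorphic_on chart_range c) \<and>
        (\<forall>t\<in>chart_range c.
           w t \<noteq> 0 \<and> chart_inv c t = proj (w t) \<and>
           (\<exists>i j. w t $ i * deriv (\<lambda>s. w s $ j) t \<noteq> w t $ j * deriv (\<lambda>s. w s $ i) t)))}"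


section \<open>Bring's curve\<close>

text \<open>The coordinates are indexed by the type \<open>5\<close> of residues modulo 5; its elements are
  1, 2, 3, 4 and 5 = 0.\<close>

definition bring_curve :: "(complex ^ 5) set set" where
  "bring_curve = {proj x | x. x \<noteq> 0 \<and>
     (\<Sum>i\<in>UNIV. x $ i) = 0 \<and> (\<Sum>i\<in>UNIV. (x $ i) ^ 2) = 0 \<and> (\<Sum>i\<in>UNIV. (x $ i) ^ 3) = 0}"

definition bring_W :: "complex \<Rightarrow> complex \<Rightarrow> complex \<Rightarrow> 5 \<Rightarrow> 5 \<Rightarrow> 5 \<Rightarrow> (complex ^ 5) set" where
  "bring_W \<alpha> \<beta> \<gamma> i j k =
     proj (\<chi> m. if m = i then \<alpha> else if m = j then \<beta> else if m = k then \<gamma> else 1)"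

text \<open>The points \<open>P\<^bsub>ijk\<^esub>\<close> and \<open>P'\<^bsub>ijk\<^esub>\<close>, with coordinates \<open>A, B, 1\<close> at the positions
  \<open>i, j, k\<close>, differ only in the order of the other two coordinates. The last argument \<open>l\<close>
  selects one of them: it is the position of \<open>\<delta>'\<close>, namely the smaller of the two
  remaining positions for \<open>P\<^bsub>ijk\<^esub>\<close> and the larger one for \<open>P'\<^bsub>ijk\<^esub>\<close>.\<close>

definition bring_P ::
  "complex \<Rightarrow> complex \<Rightarrow> complex \<Rightarrow> complex \<Rightarrow> 5 \<Rightarrow> 5 \<Rightarrow> 5 \<Rightarrow> 5 \<Rightarrow> (complex ^ 5) set" where
  "bring_P A B \<delta> \<delta>' i j k l =
     proj (\<chi> m. if m = i then A else if m = j then B else if m = k then 1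
                else if m = l then \<delta>' else \<delta>)"

end

theory Submission
  imports Defs
begin

text \<open>Write \<open>e\<^sub>1, e\<^sub>2, e\<^sub>3\<close> for the elementary symmetric functions of \<open>x\<^sub>3, x\<^sub>4, x\<^sub>5\<close>. On Bring's curve
  \<open>x\<^sub>1 + x\<^sub>2 = - e\<^sub>1\<close> and \<open>x\<^sub>1 x\<^sub>2 = e\<^sub>1\<^sup>2 - e\<^sub>2\<close>, and the vanishing of the cubes becomes the equation
  \<open>e\<^sub>1\<^sup>3 - 2 e\<^sub>1 e\<^sub>2 + e\<^sub>3 = 0\<close> of a plane cubic \<open>E\<close>. So the curve is the double cover of \<open>E\<close> given by
  exchanging \<open>x\<^sub>1\<close> and \<open>x\<^sub>2\<close>, branched where \<open>(x\<^sub>1 - x\<^sub>2)\<^sup>2 = 4 e\<^sub>2 - 3 e\<^sub>1\<^sup>2\<close> vanishes. The point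
  \<open>(\<alpha> : \<beta> : \<gamma>)\<close> of \<open>E\<close> is a branch point, with \<open>W\<^bsub>345\<^esub>\<close> above it; the tangent of \<open>E\<close> there,
  \<open>(\<alpha> - 1)\<^sup>2 x\<^sub>3 + (\<beta> - 1)\<^sup>2 x\<^sub>4 + (\<gamma> - 1)\<^sup>2 x\<^sub>5 = 0\<close>, meets \<open>E\<close> once more, in \<open>(A : B : 1)\<close>, above which lie
  \<open>P\<^bsub>345\<^esub>\<close> and \<open>P'\<^bsub>345\<^esub>\<close>. A linear form \<open>l\<close> defining this tangent therefore vanishes on the
  curve to the order 2 times 2 at \<open>W\<^bsub>345\<^esub>\<close> and simply at \<open>P\<^bsub>345\<^esub>\<close> and \<open>P'\<^bsub>345\<^esub>\<close>. This is made
  explicit by \<open>plane_cubic_coords\<close>, which writes cubic and branch conic in coordinates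
  adapted to the tangent, and carried out by \<open>tangent_order\<close>.

  The second divisor comes from the plane \<open>x\<^sub>4 = B x\<^sub>5\<close>. As \<open>x\<^sub>4\<close> and \<open>x\<^sub>5\<close> determine the
  unordered triple \<open>x\<^sub>1, x\<^sub>2, x\<^sub>3\<close>, this plane cuts out the six points whose first three
  coordinates are \<open>A, \<delta>, \<delta>'\<close> in some order, each once. They are \<open>P\<close> and \<open>P'\<close> with the
  indices 145, 245 and 345, and the last pair cancels in the function \<open>(x\<^sub>4 - B x\<^sub>5) / l\<close>.

  The first divisor is the divisor of a differential because the curve is canonical. The
  cone over the curve is the complete intersection of the hypersurfaces \<open>\<Sum> x\<^sub>i\<^sup>k = 0\<close>
  for \<open>k = 1, 2, 3\<close>, with Jacobian matrix the Vandermonde matrix up to scaling of rows. For a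
  local lift \<open>w\<close> of the curve to the cone, \<open>w\<close> and \<open>w'\<close> span the kernel of that matrix; so
  the minors \<open>w\<^sub>i w\<^sub>j' - w\<^sub>j w\<^sub>i'\<close> are, up to sign, the complementary Vandermonde
  determinants times a common factor \<open>\<phi>\<close>. This factor has no zeros and scales inversely to \<open>w\<close>, whence
  \<open>l(w) \<phi> dt\<close> is a global holomorphic differential with the zeros of \<open>l\<close>
  (\<open>residue_form_holomorphic_differential\<close>).

  Finally a divisor can only be read off in a chart, and \<open>bring_curve_chart_exists\<close> supplies
  one around every point: a suitable ratio of two coordinates is a local parameter, since the other
  three are simple roots of a cubic depending on it.\<close>

unbundle no Formal_Power_Series.fps_syntax

section \<open>The numbers defining the special points\<close>

lemma monic_quadratic_coeffs:
  fixes p q r s :: complex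
  assumes "[:q, p, 1:] = [:-r, 1:] * [:-s, 1:]"
  shows "r + s = -p" "r * s = q"
proof -
  have "coeff [:q, p, 1:] n = coeff ([:-r, 1:] * [:-s, 1:]) n" for n
    using assms by simp
  from this[of 0] this[of 1] show "r + s = -p" "r * s = q"
    by (simp_all add: algebra_simps add_eq_0_iff) algebra
qed

lemma monic_cubic_coeffs:
  fixes p q r a b c :: complex
  assumes "[:r, q, p, 1:] = [:-a, 1:] * [:-b, 1:] * [:-c, 1:]"
  shows "a + b + c = -p" "a * b + b * c + c * a = q" "a * b * c = -r"
proof -
  have "coeff [:r, q, p, 1:] n = coeff ([:-a, 1:] * [:-b, 1:] * [:-c, 1:]) n" for n
    using assms by simp
  from this[of 0] this[of 1] this[of 2]
  show "a + b + c = -p" "a * b + b * c + c * a = q" "a * b * c = -r"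
    by (simp_all add: algebra_simps add_eq_0_iff eval_nat_numeral) algebra
qed

text \<open>Everything is polynomial in \<open>\<alpha>\<close> and \<open>\<beta>\<close> and is reduced with \<open>\<alpha>\<^sup>3 = - 2 \<alpha>\<^sup>2 - 3 \<alpha> - 4\<close> and the
  quadratic equation of \<open>\<beta>\<close> over \<open>\<alpha>\<close>. These relations replace the explicit formulas from here on:
  with \<open>\<sigma> = \<delta> + \<delta>'\<close>, the elementary symmetric functions of \<open>A, B, 1\<close> are
  \<open>- \<sigma>, (9/32) \<sigma>\<^sup>2, (7/16) \<sigma>\<^sup>3\<close>; two more relations place \<open>(A, B, 1)\<close> relative to
  \<open>(\<alpha>, \<beta>, \<gamma>)\<close>, and the last one says that it lies on the tangent of the plane cubic there.\<close>

lemma bring_constants_relations: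
  fixes \<alpha> \<beta> \<gamma> A B \<delta> \<delta>' :: complex
  assumes cubic: "[:4, 3, 2, 1:] = [:-\<alpha>, 1:] * [:-\<beta>, 1:] * [:-\<gamma>, 1:]"
    and A: "A = (-43 * \<alpha>^2 - 113 * \<alpha> - 92) * \<beta> / 112 - (13 * \<alpha>^2 + 27 * \<alpha> + 20) / 28"
    and B: "B = (43 * \<alpha>^2 + 25 * \<alpha> - 4) * \<beta> / 112 + (13 * \<alpha>^2 + 3 * \<alpha> - 24) / 28"
    and quad: "[: (23 * (155 * \<alpha> + 388) * \<beta> + 92 * (97 * \<alpha> + 172)) / 6272,
            - (((11 * \<alpha> + 12) * \<beta> + 4 * (3 * \<alpha> + 2)) / 14), 1 :]
         = [:-\<delta>, 1:] * [:-\<delta>', 1:]"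
  shows "\<alpha> + \<beta> + \<gamma> = -2" "\<alpha> * \<beta> + \<beta> * \<gamma> + \<gamma> * \<alpha> = 3" "\<alpha> * \<beta> * \<gamma> = -4"
    "A + B + 1 = - (\<delta> + \<delta>')" "32 * (\<delta> * \<delta>') = 23 * (\<delta> + \<delta>') ^ 2"
    "32 * (A * B + A + B) = 9 * (\<delta> + \<delta>') ^ 2" "16 * (A * B) = 7 * (\<delta> + \<delta>') ^ 3"
    "2 * (\<alpha> * A + \<beta> * B + \<gamma>) = 3 * (\<delta> + \<delta>')"
    "8 * (\<alpha> * B + \<beta> * A + \<gamma> * A * B) = - 19 * (\<delta> + \<delta>') ^ 2"
    "(\<alpha> - 1) ^ 2 * A + (\<beta> - 1) ^ 2 * B + (\<gamma> - 1) ^ 2 = 0"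
proof -
  show e: "\<alpha> + \<beta> + \<gamma> = -2" "\<alpha> * \<beta> + \<beta> * \<gamma> + \<gamma> * \<alpha> = 3" "\<alpha> * \<beta> * \<gamma> = -4"
    using monic_cubic_coeffs[OF cubic] by simp_all
  have s: "\<delta> + \<delta>' = ((11 * \<alpha> + 12) * \<beta> + 4 * (3 * \<alpha> + 2)) / 14" and 
     q: "\<delta> * \<delta>' = (23 * (155 * \<alpha> + 388) * \<beta> + 92 * (97 * \<alpha> + 172)) / 6272"
    using monic_quadratic_coeffs[OF quad] by simp_all
  have g: "\<gamma> = -2 - \<alpha> - \<beta>" using e(1) by algebra
  have b2: "\<beta>^2 = -(\<alpha>+2)*\<beta> - (\<alpha>^2+2*\<alpha>+3)" using e(2) unfolding g by (simp add: power2_eq_square algebra_simps) algebra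
  have a3: "\<alpha>^3 = -2*\<alpha>^2-3*\<alpha>-4" using e(3) b2 unfolding g by algebra
  have s2: "196 * (\<delta> + \<delta>') ^ 2 = 688 + 388 * \<alpha> + 388*\<beta> + 155*\<alpha>*\<beta>"
    unfolding s using b2 a3 by (simp add: field_simps) algebra
  have AB: "6272 * (A*B) = 16048 + 8868 * \<alpha> + 8868 *\<beta> + 6323 * \<alpha>*\<beta>"
    unfolding A B using b2 a3 by (simp add: field_simps) algebra
  show AB1: "A + B + 1 = - (\<delta> + \<delta>')" unfolding A B s by (simp add: field_simps) 
  show q2: "32 * (\<delta> * \<delta>') = 23 * (\<delta> + \<delta>') ^ 2" using s2 unfolding q by (simp add: field_simps) algebra
  show "32 * (A * B + A + B) = 9 * (\<delta> + \<delta>') ^ 2" using AB AB1 s2 s by (simp add: field_simps) algebra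
  show "16 * (A * B) = 7 * (\<delta> + \<delta>') ^ 3" using AB s2 s a3 b2 by (simp add: field_simps) algebra
  show "2 * (\<alpha> * A + \<beta> * B + \<gamma>) = 3 * (\<delta> + \<delta>')" unfolding A B g s using a3 b2 by (simp add: field_simps) algebra
  show "8 * (\<alpha> * B + \<beta> * A + \<gamma> * A * B) = - 19 * (\<delta> + \<delta>') ^ 2" using s2 AB  a3 b2 unfolding A B g by (simp add: field_simps) algebra
  show "(\<alpha> - 1) ^ 2 * A + (\<beta> - 1) ^ 2 * B + (\<gamma> - 1) ^ 2 = 0" using a3 b2 unfolding A B g by (simp add: field_simps) algebra
qed

text \<open>The quotient of Bring's curve by the exchange of the first two coordinates, in the plane
  with the coordinates \<open>x\<^sub>3, x\<^sub>4, x\<^sub>5\<close>.\<close>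

definition plane_cubic :: "complex \<Rightarrow> complex \<Rightarrow> complex \<Rightarrow> complex" where
  "plane_cubic x y z = (x + y + z) ^ 3 - 2 * (x + y + z) * (x * y + y * z + z * x) + x * y * z"

text \<open>The discriminant \<open>(x\<^sub>1 - x\<^sub>2)\<^sup>2\<close>, as a function on the quotient.\<close>

definition branch_conic :: "complex \<Rightarrow> complex \<Rightarrow> complex \<Rightarrow> complex" where
  "branch_conic x y z = 4 * (x * y + y * z + z * x) - 3 * (x + y + z) ^ 2"

text \<open>The partial derivative of the cubic by its first argument; by symmetry, cyclic shifts of the
  arguments give the other two.\<close>

definition plane_cubic_dx :: "complex \<Rightarrow> complex \<Rightarrow> complex \<Rightarrow> complex" where
  "plane_cubic_dx x y z = 3 * (x + y + z) ^ 2 - 2 * (x * y + y * z + z * x)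
     - 2 * (x + y + z) * (y + z) + y * z"

text \<open>Taylor expansion of the cubic at two points \<open>(a, b, c)\<close> and \<open>(p, q, r)\<close>: the mixed coefficients
  are its polars. The third coordinate direction is the first unit vector, with coefficient \<open>l\<close>.\<close>

lemma plane_cubic_pencil:
  "plane_cubic (n * a + m * p + l) (n * b + m * q) (n * c + m * r) =
     n^3 * plane_cubic a b c
     + n^2 * m * (p * plane_cubic_dx a b c + q * plane_cubic_dx b c a + r * plane_cubic_dx c a b)
     + n * m^2 * (a * plane_cubic_dx p q r + b * plane_cubic_dx q r p + c * plane_cubic_dx r p q)
     + m^3 * plane_cubic p q r
     + l * (plane_cubic_dx (n * a + m * p) (n * b + m * q) (n * c + m * r)
            + l * (3 * (n * a + m * p) + (n * b + m * q) + (n * c + m * r)) + l^2)"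
  unfolding plane_cubic_def plane_cubic_dx_def by algebra

lemma branch_conic_pencil:
  "branch_conic (n * a + m * p + l) (n * b + m * q) (n * c + m * r) =
     n^2 * branch_conic a b c
     + n * m * (4 * (a + b + c) * (p + q + r) - 4 * (a * p + b * q + c * r) - 6 * (a + b + c) * (p + q + r))
     + m^2 * branch_conic p q r
     + l * (4 * (n * b + m * q + n * c + m * r) - 6 * (n * a + m * p + n * b + m * q + n * c + m * r) - 3 * l)"
  unfolding branch_conic_def by algebra

text \<open>The relations between the constants that the geometry needs; \<open>bring_constants_relations\<close> shows
  that the constants of the theorem satisfy them.\<close>

locale bring_constants =
  fixes \<alpha> \<beta> \<gamma> A B \<delta> \<delta>' :: complex
  assumes e_W: "\<alpha> + \<beta> + \<gamma> = -2" "\<alpha> * \<beta> + \<beta> * \<gamma> + \<gamma> * \<alpha> = 3" "\<alpha> * \<beta> * \<gamma> = -4"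
    and sum_AB: "A + B + 1 = - (\<delta> + \<delta>')"
    and delta_prod: "32 * (\<delta> * \<delta>') = 23 * (\<delta> + \<delta>') ^ 2"
    and e2_P: "32 * (A * B + A + B) = 9 * (\<delta> + \<delta>') ^ 2"
    and e3_P: "16 * (A * B) = 7 * (\<delta> + \<delta>') ^ 3"
    and W_dot_P: "2 * (\<alpha> * A + \<beta> * B + \<gamma>) = 3 * (\<delta> + \<delta>')"
    and W_dot_P_adj: "8 * (\<alpha> * B + \<beta> * A + \<gamma> * A * B) = - 19 * (\<delta> + \<delta>') ^ 2"
    and tangent: "(\<alpha> - 1) ^ 2 * A + (\<beta> - 1) ^ 2 * B + (\<gamma> - 1) ^ 2 = 0"
begin

definition \<sigma> where "\<sigma> = \<delta> + \<delta>'"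
definition \<kappa> where "\<kappa> = \<beta> - \<gamma> * B"

text \<open>The cofactor of \<open>l\<close> in the expansion of the cubic at \<open>(\<alpha>, \<beta>, \<gamma>)\<close> and \<open>(A, B, 1)\<close>. The next
  definition is its analogue for the branch conic.\<close>

definition residual_conic where
  "residual_conic n m l =
     plane_cubic_dx (n * \<alpha> + m * A) (n * \<beta> + m * B) (n * \<gamma> + m)
     + l * (3 * (n * \<alpha> + m * A) + (n * \<beta> + m * B) + (n * \<gamma> + m)) + l^2"

definition residual_line where
  "residual_line n m l = 
    4 * (n * \<beta> + m * B + n * \<gamma> + m) - 6 * (n * \<alpha> + m * A + n * \<beta> + m * B + n * \<gamma> + m) - 3 * l"

text \<open>Otherwise \<open>A + B = - 1\<close>, while \<open>A B = 0\<close> and \<open>A B + A + B = 0\<close>. The other nondegeneracy statements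
  about \<open>A, B, \<delta>, \<delta>'\<close> reduce to this one by homogeneity.\<close>

lemma sigma_nonzero: "\<sigma> \<noteq> 0"
proof
  assume "\<sigma> = 0"
  then have "A + B + 1 = 0" "A * B + A + B = 0" "A * B = 0"
    using sum_AB e2_P e3_P unfolding \<sigma>_def by algebra+
  then show False by algebra
qed

lemma delta_distinct: "\<delta> \<noteq> \<delta>'"
proof
  assume "\<delta> = \<delta>'"
  then have "32 * \<delta>^2 = 92 * \<delta>^2" using delta_prod by (simp add: power2_eq_square)
  then have "\<delta> = 0" by simp
  then have "\<sigma> = 0" using \<open>\<delta> = \<delta>'\<close> unfolding \<sigma>_def by simp
  then show False using sigma_nonzero by simp
qed

text \<open>Both \<open>A\<close> and the roots \<open>t, t'\<close> are \<open>\<sigma>\<close> times roots of polynomials with rational coefficients,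
  a cubic for \<open>A\<close> and a quadratic for \<open>t\<close>. Division with remainder shows that a common root
  would be \<open>6 \<sigma> / 5\<close>, which is not a root of the quadratic.\<close>

lemma A_not_root:
  assumes "t + t' = \<sigma>" "32 * (t * t') = 23 * \<sigma> ^ 2"
  shows "A \<noteq> t"
proof
  assume "A = t"
  have q: "32 * A^2 - 32 * \<sigma> * A + 23 * \<sigma>^2 = 0"
  proof -
    have "t' = \<sigma> - A" using assms(1) \<open>A = t\<close> by (simp add: algebra_simps)
    then have "32 * (A * (\<sigma> - A)) = 23 * \<sigma> ^ 2" using assms(2) \<open>A = t\<close> by simp
    then show ?thesis by algebra
  qed
  have c: "32 * A^3 + 32 * \<sigma> * A^2 + 9 * \<sigma>^2 * A - 14 * \<sigma>^3 = 0"
    using sum_AB e2_P e3_P unfolding \<sigma>_def by algebra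
  have "\<sigma>^2 * (50 * A - 60 * \<sigma>) = 0"
    using q c by algebra
  then have "5 * A = 6 * \<sigma>" using sigma_nonzero by simp
  then have "\<sigma>^2 = 0" using q by algebra
  then show False using sigma_nonzero by simp
qed

lemma A_distinct: "A \<noteq> \<delta>" "A \<noteq> \<delta>'"
  using A_not_root[of \<delta> \<delta>'] A_not_root[of \<delta>' \<delta>] delta_prod by (auto simp: \<sigma>_def algebra_simps)

lemma root_eqs: "\<alpha>^3 + 2 * \<alpha>^2 + 3 * \<alpha> + 4 = 0" "\<beta>^3 + 2 * \<beta>^2 + 3 * \<beta> + 4 = 0" 
  "\<gamma>^3 + 2 * \<gamma>^2 + 3 * \<gamma> + 4 = 0"
  using e_W by algebra+

lemma W_not_one: "\<alpha> \<noteq> 1" "\<beta> \<noteq> 1" "\<gamma> \<noteq> 1"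
  using root_eqs by auto

lemma double_root: 
  fixes r t :: complex assumes "2 * r + t = -2" "r^2 + 2 * r * t = 3" "r^2 * t = -4" shows False
proof -
  have a: "3 * r^2 + 4 * r + 3 = 0" using assms by algebra
  have b: "5 * r + 15 = 0" using a assms by algebra
  then have "r = -3" by algebra
  then show False using a by simp
qed

lemma W_distinct: "\<alpha> \<noteq> \<beta>" "\<beta> \<noteq> \<gamma>" "\<alpha> \<noteq> \<gamma>"
proof -
  show "\<alpha> \<noteq> \<beta>" using double_root[of \<alpha> \<gamma>] e_W by (auto simp: algebra_simps power2_eq_square)
  show "\<beta> \<noteq> \<gamma>" using double_root[of \<beta> \<alpha>] e_W by (auto simp: algebra_simps power2_eq_square)
  show "\<alpha> \<noteq> \<gamma>" using double_root[of \<alpha> \<beta>] e_W by (auto simp: algebra_simps power2_eq_square)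
qed

text \<open>If \<open>\<beta> = \<gamma> B\<close>, then the tangent at \<open>(\<alpha>, \<beta>, \<gamma>)\<close>, which contains both points, gives
  \<open>\<alpha> = \<gamma> A\<close> as well. So both points coincide in the plane; but their invariants \<open>e\<^sub>2 / e\<^sub>1\<^sup>2\<close>
  are 3/4 and 9/32.\<close>

lemma kappa_nonzero: "\<kappa> \<noteq> 0"
proof
  assume "\<kappa> = 0"
  then have b: "\<beta> = \<gamma> * B" by (simp add: \<kappa>_def)
  \<comment> \<open>Euler's relation: the tangent contains its point of contact.\<close>
  have "(\<alpha> - 1)^2 * \<alpha> + (\<beta> - 1)^2 * \<beta> + (\<gamma> - 1)^2 * \<gamma> = 0"
    using e_W by algebra
  then have "(\<alpha> - 1)^2 * (\<alpha> - \<gamma> * A) = 0"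
    using tangent b by algebra
  then have a: "\<alpha> = \<gamma> * A" using W_not_one by simp
  have "\<gamma> * \<sigma> = 2" using a b e_W(1) sum_AB unfolding \<sigma>_def by algebra
  moreover have "\<gamma>^2 * (9 * \<sigma>^2) = 32 * 3" using a b e_W(2) e2_P unfolding \<sigma>_def by algebra
  moreover have "\<gamma>^2 * (9 * \<sigma>^2) = 9 * (\<gamma> * \<sigma>)^2" by algebra
  ultimately show False by simp
qed

text \<open>The adapted coordinates \<open>n, m, l\<close> are given by
  \<open>\<kappa> (x, y, z) = n (\<alpha>, \<beta>, \<gamma>) + m (A, B, 1) + l (1, 0, 0)\<close>. On the tangent \<open>l = 0\<close> the cubic has
  a double zero at \<open>m = 0\<close> and a simple one at \<open>n = 0\<close>, so that only \<open>n m\<^sup>2\<close> remains; the branch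
  conic vanishes at \<open>m = 0\<close>, and its coefficient \<open>- 10 \<sigma>\<close> of \<open>n m\<close> shows that it does so simply.\<close>

lemma plane_cubic_coords:
  fixes x y z :: complex
  defines "n \<equiv> y - B * z" and "m \<equiv> \<beta> * z - \<gamma> * y"
    and "l \<equiv> \<kappa> * x + (\<gamma> * A - \<alpha>) * y + (\<alpha> * B - \<beta> * A) * z"
  shows "\<kappa>^3 * plane_cubic x y z = - (25/4) * \<sigma>^2 * n * m^2 + l * residual_conic n m l"
    "\<kappa>^2 * branch_conic x y z = m * (- 10 * \<sigma> * n - (15/8) * \<sigma>^2 * m) + l * residual_line n m l"
proof -
  have k: "\<kappa> * x = n * \<alpha> + m * A + l" "\<kappa> * y = n * \<beta> + m * B" "\<kappa> * z = n * \<gamma> + m * 1"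
    unfolding n_def m_def l_def \<kappa>_def by algebra+
  have W: "plane_cubic \<alpha> \<beta> \<gamma> = 0" "branch_conic \<alpha> \<beta> \<gamma> = 0"
    unfolding plane_cubic_def branch_conic_def e_W by simp_all
  have P: "plane_cubic A B 1 = 0" 
    unfolding plane_cubic_def using sum_AB e2_P e3_P  by algebra
  have P': "branch_conic A B 1 = - (15/8) * \<sigma>^2"
    unfolding branch_conic_def \<sigma>_def using sum_AB e2_P by (simp add: field_simps) algebra
  have dW: "plane_cubic_dx \<alpha> \<beta> \<gamma> = (\<alpha> - 1)^2" "plane_cubic_dx \<beta> \<gamma> \<alpha> = (\<beta> - 1)^2" "plane_cubic_dx \<gamma> \<alpha> \<beta> = (\<gamma> - 1)^2"
    unfolding plane_cubic_dx_def using e_W by algebra+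
  \<comment> \<open>The coefficients of \<open>n\<^sup>2 m\<close> and \<open>n m\<^sup>2\<close> in the cubic and of \<open>n m\<close> in the conic.\<close>
  have 1: "A * plane_cubic_dx \<alpha> \<beta> \<gamma> + B * plane_cubic_dx \<beta> \<gamma> \<alpha> + 1 * plane_cubic_dx \<gamma> \<alpha> \<beta> = 0"
    using tangent unfolding dW by (simp add: algebra_simps)
  have 2: "\<alpha> * plane_cubic_dx A B 1 + \<beta> * plane_cubic_dx B 1 A + \<gamma> * plane_cubic_dx 1 A B = - (25/4) * \<sigma>^2"
    using sum_AB e2_P e3_P e_W W_dot_P W_dot_P_adj unfolding plane_cubic_dx_def \<sigma>_def
    by (simp add: field_simps) algebra
  have 3: "4 * (\<alpha> + \<beta> + \<gamma>) * (A + B + 1) - 4 * (\<alpha> * A + \<beta> * B + \<gamma> * 1) - 6 * (\<alpha> + \<beta> + \<gamma>) * (A + B + 1) = - 10 * \<sigma>"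
    using sum_AB W_dot_P unfolding e_W \<sigma>_def by algebra
  have "\<kappa>^3 * plane_cubic x y z = plane_cubic (\<kappa> * x) (\<kappa> * y) (\<kappa> * z)"
    unfolding plane_cubic_def by algebra
  then show "\<kappa>^3 * plane_cubic x y z = - (25/4) * \<sigma>^2 * n * m^2 + l * residual_conic n m l"
    unfolding k plane_cubic_pencil W P 1 2 residual_conic_def by simp
  have "\<kappa>^2 * branch_conic x y z = branch_conic (\<kappa> * x) (\<kappa> * y) (\<kappa> * z)"
    unfolding branch_conic_def by algebra
  then show "\<kappa>^2 * branch_conic x y z = m * (- 10 * \<sigma> * n - (15/8) * \<sigma>^2 * m) + l * residual_line n m l"
    unfolding k branch_conic_pencil W P' 3 residual_line_def by (simp add: algebra_simps power2_eq_square)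
qed

lemma residual_conic_at_W: "residual_conic n 0 0 = n^2 * (\<alpha> - 1)^2"
  unfolding residual_conic_def plane_cubic_dx_def using e_W by (simp, algebra)
end

section \<open>Linear sections of Bring's curve\<close>

lemma triple_eq_perm:
  fixes x y z a b c :: complex
  assumes "x + y + z = a + b + c" "x * y + y * z + z * x = a * b + b * c + c * a" "x * y * z = a * b * c"
  shows "(x, y, z) \<in> {(a,b,c), (a,c,b), (b,a,c), (b,c,a), (c,a,b), (c,b,a)}"
proof -
  have pair: "(y' = b' \<and> z' = c') \<or> (y' = c' \<and> z' = b')"
    if "y' + z' = b' + c'" "y' * z' = b' * c'" for y' z' b' c' :: complex
  proof -
    have "(y' - b') * (y' - c') = 0" using that by algebra
    then show ?thesis using that by auto
  qed
  have "(x - a) * (x - b) * (x - c) = 0" using assms by algebra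
  then consider "x = a" | "x = b" | "x = c" by auto
  then show ?thesis
  proof cases
    case 1
    have s: "y + z = b + c" using assms(1) 1 by (simp add: algebra_simps)
    moreover have "y * z = b * c" using assms(2) s unfolding 1 by algebra
    ultimately have "(y = b \<and> z = c) \<or> (y = c \<and> z = b)" by (rule pair)
    then show ?thesis using 1 by auto
  next
    case 2
    have s: "y + z = a + c" using assms(1) 2 by (simp add: algebra_simps)
    moreover have "y * z = a * c" using assms(2) s unfolding 2 by algebra
    ultimately have "(y = a \<and> z = c) \<or> (y = c \<and> z = a)" by (rule pair)
    then show ?thesis using 2 by auto
  next
    case 3
    have s: "y + z = a + b" using assms(1) 3 by (simp add: algebra_simps)
    moreover have "y * z = a * b" using assms(2) s unfolding 3 by algebra
    ultimately have "(y = a \<and> z = b) \<or> (y = b \<and> z = a)" by (rule pair)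
    then show ?thesis using 3 by auto
  qed
qed

definition bring_eqs where
  "bring_eqs x1 x2 x3 x4 x5 \<longleftrightarrow> x1 + x2 + x3 + x4 + x5 = (0::complex)
     \<and> x1^2 + x2^2 + x3^2 + x4^2 + x5^2 = 0 \<and> x1^3 + x2^3 + x3^3 + x4^3 + x5^3 = 0"

text \<open>Elimination of \<open>x\<^sub>1\<close> and \<open>x\<^sub>2\<close> by means of their sum and product.\<close>

lemma bring_eqs_imp_plane:
  assumes "bring_eqs x1 x2 x3 x4 x5"
  shows "plane_cubic x3 x4 x5 = 0" "(x1 - x2)^2 = branch_conic x3 x4 x5"
proof -
  have 1: "x1 + x2 = - (x3 + x4 + x5)" "x1^2 + x2^2 = - (x3^2 + x4^2 + x5^2)" "x1^3 + x2^3 = - (x3^3 + x4^3 + x5^3)"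
    using assms by (auto simp: bring_eqs_def add_eq_0_iff2 algebra_simps; algebra)+
  show "(x1 - x2)^2 = branch_conic x3 x4 x5" unfolding branch_conic_def using 1 by algebra
  have "3 * plane_cubic x3 x4 x5 = 0" unfolding plane_cubic_def using 1 by algebra
  then show "plane_cubic x3 x4 x5 = 0" by simp
qed

lemma bring_eqs_two_zero:
  assumes "bring_eqs 0 0 x y z" shows "x = 0" "y = 0" "z = 0"
proof -
  have 1: "x + y + z = 0 + 0 + 0" "x * y + y * z + z * x = 0*0+0*0+0*0" "x * y * z = 0*0*0"
    using assms unfolding bring_eqs_def by (simp; algebra)+
  from triple_eq_perm[OF this] show "x = 0" "y = 0" "z = 0" by auto
qed

text \<open>This lemma and the next one exclude all coincidences of coordinates except that of a single
  pair.\<close>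

lemma bring_eqs_triple:
  assumes "bring_eqs a a a b c" shows "a = 0 \<and> b = 0 \<and> c = 0"
proof -
  \<comment> \<open>After elimination of \<open>b + c\<close> and \<open>b c\<close>, the sum of the cubes is \<open>30 a\<^sup>3\<close>.\<close>
  have "a^3 = 0" using assms unfolding bring_eqs_def by algebra
  then show ?thesis using bring_eqs_two_zero[of a b c] assms by auto
qed

lemma bring_eqs_two_pairs:
  assumes "bring_eqs a a b b c" shows "a = 0 \<and> b = 0 \<and> c = 0"
proof -
  \<comment> \<open>The equations are homogeneous without a common zero, so the ideal that they generate contains a power of \<open>a\<close>.\<close>
  have "a^4 = 0" using assms unfolding bring_eqs_def by algebra
  then show ?thesis using bring_eqs_two_zero[of b b c] assms by auto
qed

text \<open>The maximal minors of the Jacobian matrix of the three equations, up to constants.\<close>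

definition vand3 :: "complex \<Rightarrow> complex \<Rightarrow> complex \<Rightarrow> complex" where
  "vand3 x y z = (y - x) * (z - x) * (z - y)"

text \<open>At most one pair of coordinates coincides, and no pair is contained both in \<open>{1, 2, 3}\<close> and in
  \<open>{1, 4, 5}\<close>. Hence two of the ten minors suffice to cover the curve.\<close>

lemma bring_eqs_vand3:
  assumes e: "bring_eqs x1 x2 x3 x4 x5" and nz: "\<not> (x1 = 0 \<and> x2 = 0 \<and> x3 = 0 \<and> x4 = 0 \<and> x5 = 0)"
  shows "vand3 x1 x2 x3 \<noteq> 0 \<or> vand3 x1 x4 x5 \<noteq> 0"
proof (rule ccontr)
  assume "\<not> ?thesis"
  then consider "x1 = x2" "x1 = x4"
    | "x1 = x2" "x1 = x5"
    | "x1 = x2" "x4 = x5"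
    | "x1 = x3" "x1 = x4"
    | "x1 = x3" "x1 = x5"
    | "x1 = x3" "x4 = x5"
    | "x2 = x3" "x1 = x4"
    | "x2 = x3" "x1 = x5"
    | "x2 = x3" "x4 = x5"
    by (auto simp: vand3_def)
  then show False
  proof cases
    case 1
    then have "bring_eqs x1 x1 x1 x3 x5" using e unfolding bring_eqs_def by (simp add: algebra_simps)
    from bring_eqs_triple[OF this] show False using 1 nz by simp
  next
    case 2
    then have "bring_eqs x1 x1 x1 x3 x4" using e unfolding bring_eqs_def by (simp add: algebra_simps)
    from bring_eqs_triple[OF this] show False using 2 nz by simp
  next
    case 3
    then have "bring_eqs x1 x1 x4 x4 x3" using e unfolding bring_eqs_def by (simp add: algebra_simps)
    from bring_eqs_two_pairs[OF this] show False using 3 nz by simp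
  next
    case 4
    then have "bring_eqs x1 x1 x1 x2 x5" using e unfolding bring_eqs_def by (simp add: algebra_simps)
    from bring_eqs_triple[OF this] show False using 4 nz by simp
  next
    case 5
    then have "bring_eqs x1 x1 x1 x2 x4" using e unfolding bring_eqs_def by (simp add: algebra_simps)
    from bring_eqs_triple[OF this] show False using 5 nz by simp
  next
    case 6
    then have "bring_eqs x1 x1 x4 x4 x2" using e unfolding bring_eqs_def by (simp add: algebra_simps)
    from bring_eqs_two_pairs[OF this] show False using 6 nz by simp
  next
    case 7
    then have "bring_eqs x2 x2 x1 x1 x5" using e unfolding bring_eqs_def by (simp add: algebra_simps)
    from bring_eqs_two_pairs[OF this] show False using 7 nz by simp
  next
    case 8
    then have "bring_eqs x2 x2 x1 x1 x4" using e unfolding bring_eqs_def by (simp add: algebra_simps)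
    from bring_eqs_two_pairs[OF this] show False using 8 nz by simp
  next
    case 9
    then have "bring_eqs x2 x2 x4 x4 x1" using e unfolding bring_eqs_def by (simp add: algebra_simps)
    from bring_eqs_two_pairs[OF this] show False using 9 nz by simp
  qed
qed

text \<open>The vector \<open>b\<close> lies in the tangent plane of the cone over the curve at \<open>x\<close>.\<close>

definition kernel_eqs where
  "kernel_eqs x1 x2 x3 x4 x5 b1 b2 b3 b4 b5 \<longleftrightarrow> b1 + b2 + b3 + b4 + b5 = (0::complex)
     \<and> x1 * b1 + x2 * b2 + x3 * b3 + x4 * b4 + x5 * b5 = 0
     \<and> x1^2 * b1 + x2^2 * b2 + x3^2 * b3 + x4^2 * b4 + x5^2 * b5 = 0"

text \<open>Proportionality of the minors of two kernel vectors to the complementary Vandermonde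
  determinants, for the two complementary pairs needed for the covering of the curve.\<close>

lemma kernel_minors:
  assumes "kernel_eqs x1 x2 x3 x4 x5 a1 a2 a3 a4 a5" "kernel_eqs x1 x2 x3 x4 x5 b1 b2 b3 b4 b5"
  shows "(a4 * b5 - a5 * b4) * vand3 x1 x4 x5 = (a2 * b3 - a3 * b2) * vand3 x1 x2 x3"
  using assms unfolding kernel_eqs_def vand3_def by algebra

lemma kernel_zero:
  assumes "kernel_eqs x1 x2 x3 x4 x5 0 0 b3 b4 b5" "vand3 x3 x4 x5 \<noteq> 0"
  shows "b3 = 0" "b4 = 0" "b5 = 0"
proof -
  have "b3 * ((x3 - x4) * (x3 - x5)) = 0" "b4 * ((x4 - x3) * (x4 - x5)) = 0" "b5 * ((x5 - x3) * (x5 - x4)) = 0"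
    using assms(1) unfolding kernel_eqs_def by algebra+
  then show "b3 = 0" "b4 = 0" "b5 = 0" using assms(2) by (auto simp: vand3_def)
qed

context bring_constants begin

lemma bring_eqs_W: "bring_eqs 1 1 \<alpha> \<beta> \<gamma>"
  unfolding bring_eqs_def power_one using e_W by (intro conjI; algebra)

lemma bring_eqs_P: "bring_eqs \<delta>' \<delta> A B 1"
proof -
  have "\<delta>' + \<delta> + A + B + 1 = 0" using sum_AB by algebra
  moreover have "\<delta>'^2 + \<delta>^2 + A^2 + B^2 + 1 = 0"
    using sum_AB delta_prod e2_P by algebra
  moreover have "\<delta>'^3 + \<delta>^3 + A^3 + B^3 + 1 = 0"
    using sum_AB delta_prod e2_P e3_P by algebra
  ultimately show ?thesis by (simp add: bring_eqs_def)
qed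

text \<open>On the tangent the cubic is \<open>n m\<^sup>2\<close> up to a constant, so a zero lies over one of the two
  points \<open>m = 0\<close> and \<open>n = 0\<close>; sum and discriminant of \<open>x\<^sub>1, x\<^sub>2\<close> then determine the fibre.\<close>

lemma tangent_zero:
  assumes e: "bring_eqs x1 x2 x3 x4 x5" and l: "\<kappa> * x3 + (\<gamma> * A - \<alpha>) * x4 + (\<alpha> * B - \<beta> * A) * x5 = 0"
  shows "\<exists>c. (x1, x2, x3, x4, x5) \<in> {(c, c, c * \<alpha>, c * \<beta>, c * \<gamma>),
           (c * \<delta>', c * \<delta>, c * A, c * B, c), (c * \<delta>, c * \<delta>', c * A, c * B, c)}"
proof -
  define n where "n = x4 - B * x5"
  define m where "m = \<beta> * x5 - \<gamma> * x4"
  have k: "\<kappa> * x3 = n * \<alpha> + m * A" "\<kappa> * x4 = n * \<beta> + m * B" "\<kappa> * x5 = n * \<gamma> + m"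
    using l unfolding n_def m_def \<kappa>_def by algebra+
  have "n * m^2 = 0"
    using plane_cubic_coords(1)[of x3 x4 x5] bring_eqs_imp_plane(1)[OF e] l sigma_nonzero
    unfolding n_def m_def by simp
  then consider "m = 0" | "n = 0" by auto
  then show ?thesis
  proof cases
    case 1
    define c where "c = n / \<kappa>"
    have c: "x3 = c * \<alpha>" "x4 = c * \<beta>" "x5 = c * \<gamma>"
      using k 1 kappa_nonzero unfolding c_def by (simp_all add: field_simps)
    have "(x1 - x2)^2 = c^2 * branch_conic \<alpha> \<beta> \<gamma>"
      unfolding bring_eqs_imp_plane(2)[OF e] c branch_conic_def by algebra
    also have "branch_conic \<alpha> \<beta> \<gamma> = 0" unfolding branch_conic_def e_W by simp
    finally have "x1 = x2" by simp
    moreover have "x1 + x2 = 2 * c" using e e_W(1) unfolding bring_eqs_def c by algebra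
    ultimately show ?thesis using c by (intro exI[of _ c]) simp
  next
    case 2
    define c where "c = m / \<kappa>"
    have c: "x3 = c * A" "x4 = c * B" "x5 = c * 1"
      using k 2 kappa_nonzero unfolding c_def by (simp_all add: field_simps)
    have s: "x1 + x2 = c * \<delta> + c * \<delta>'" using e sum_AB unfolding bring_eqs_def c by algebra
    have "(x1 - x2)^2 = c^2 * (\<delta>' - \<delta>)^2"
      unfolding bring_eqs_imp_plane(2)[OF e] bring_eqs_imp_plane(2)[OF bring_eqs_P] c branch_conic_def by algebra
    then have "(x1 - c * \<delta>) * (x1 - c * \<delta>') = 0" using s by algebra
    then show ?thesis using c s by (intro exI[of _ c]) auto
  qed
qed

text \<open>The first three power sums of \<open>x\<^sub>1, x\<^sub>2, x\<^sub>3\<close> are determined by \<open>x\<^sub>4\<close> and \<open>x\<^sub>5\<close>, so they are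
  those of \<open>x\<^sub>5 A, x\<^sub>5 \<delta>, x\<^sub>5 \<delta>'\<close>.\<close>

lemma P_line_zero:
  assumes e: "bring_eqs x1 x2 x3 x4 x5" and n: "x4 = B * x5"
  shows "x4 = x5 * B" "(x1, x2, x3) \<in> {(x5*A,x5*\<delta>,x5*\<delta>'), (x5*A,x5*\<delta>',x5*\<delta>), (x5*\<delta>,x5*A,x5*\<delta>'),
     (x5*\<delta>,x5*\<delta>',x5*A), (x5*\<delta>',x5*A,x5*\<delta>), (x5*\<delta>',x5*\<delta>,x5*A)}"
proof -
  show "x4 = x5 * B" using n by simp
  define y where "y = x5"
  have P: "\<delta>' + \<delta> + A + B + 1 = 0" "\<delta>'^2 + \<delta>^2 + A^2 + B^2 + 1 = 0" "\<delta>'^3 + \<delta>^3 + A^3 + B^3 + 1 = 0"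
    using bring_eqs_P by (auto simp: bring_eqs_def)
  have E: "x1 + x2 + x3 + B * y + y = 0" "x1^2 + x2^2 + x3^2 + B^2 * y^2 + y^2 = 0" "x1^3 + x2^3 + x3^3 + B^3 * y^3 + y^3 = 0"
    using e unfolding bring_eqs_def n y_def by (auto simp: power_mult_distrib)
  have 1: "x1 + x2 + x3 = y * A + y * \<delta> + y * \<delta>'" using P(1) E(1) by algebra
  have "x1^2 + x2^2 + x3^2 = y^2 * (A^2 + \<delta>^2 + \<delta>'^2)" using P(2) E(2) by algebra
  then have 2: "x1 * x2 + x2 * x3 + x3 * x1 = y * A * (y * \<delta>) + y * \<delta> * (y * \<delta>') + y * \<delta>' * (y * A)"
    using 1 by algebra
  have "x1^3 + x2^3 + x3^3 = y^3 * (A^3 + \<delta>^3 + \<delta>'^3)" using P(3) E(3) by algebra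
  then have "3 * (x1 * x2 * x3) = 3 * (y * A * (y * \<delta>) * (y * \<delta>'))" using 1 2 by algebra
  then have 3: "x1 * x2 * x3 = y * A * (y * \<delta>) * (y * \<delta>')" by simp
  show "(x1, x2, x3) \<in> {(x5*A,x5*\<delta>,x5*\<delta>'), (x5*A,x5*\<delta>',x5*\<delta>), (x5*\<delta>,x5*A,x5*\<delta>'),
     (x5*\<delta>,x5*\<delta>',x5*A), (x5*\<delta>',x5*A,x5*\<delta>), (x5*\<delta>',x5*\<delta>,x5*A)}"
    using triple_eq_perm[OF 1 2 3] unfolding y_def by simp
qed
end

section \<open>Local orders of functions of one variable\<close>

text \<open>The order of vanishing as a relation: unlike \<open>zorder\<close> it excludes functions vanishing near
  the point, and it behaves well under products. The value at the point itself is irrelevant.\<close>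

definition local_order :: "(complex \<Rightarrow> complex) \<Rightarrow> complex \<Rightarrow> int \<Rightarrow> bool" where
  "local_order g z n \<longleftrightarrow>
     (\<exists>u. u analytic_on {z} \<and> u z \<noteq> 0 \<and> (\<forall>\<^sub>F t in at z. g t = u t * (t - z) powi n))"

lemma local_order_zorder:
  assumes "local_order g z n"
  shows "zorder g z = n"
proof -
  obtain u where u: "u analytic_on {z}" "u z \<noteq> 0" "\<forall>\<^sub>F t in at z. g t = u t * (t - z) powi n"
    using assms unfolding local_order_def by blast
  obtain S where S: "open S" "z \<in> S" "u holomorphic_on S"
    using u(1) analytic_at by blast
  have "zorder (\<lambda>t. u t * (t - z) powi n) z = n"
    by (rule zorder_eqI[OF S u(2)]) simp
  then show ?thesis using zorder_cong[OF u(3) refl] by simp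
qed

lemma local_order_eventually_nonzero:
  assumes "local_order g z n"
  shows "\<forall>\<^sub>F t in at z. g t \<noteq> 0"
proof -
  obtain u where u: "u analytic_on {z}" "u z \<noteq> 0" "\<forall>\<^sub>F t in at z. g t = u t * (t - z) powi n"
    using assms unfolding local_order_def by blast
  have "\<forall>\<^sub>F t in at z. u t \<noteq> 0" using analytic_at_neq_imp_eventually_neq[OF u(1,2)] .
  moreover have "\<forall>\<^sub>F t in at z. t \<noteq> z" by (simp add: eventually_at_filter)
  ultimately show ?thesis using u(3) by eventually_elim simp
qed

lemma local_order_cong:
  assumes "local_order f z n" "\<forall>\<^sub>F t in at z. g t = f t"
  shows "local_order g z n"
proof -
  obtain u where u: "u analytic_on {z}" "u z \<noteq> 0" "\<forall>\<^sub>F t in at z. f t = u t * (t - z) powi n"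
    using assms unfolding local_order_def by blast
  have "\<forall>\<^sub>F t in at z. g t = u t * (t - z) powi n"
    using u(3) assms(2) by eventually_elim simp
  then show ?thesis using u unfolding local_order_def by blast
qed

lemma local_order_unit: "u analytic_on {z} \<Longrightarrow> u z \<noteq> 0 \<Longrightarrow> local_order u z 0"
  unfolding local_order_def by (intro exI[of _ u]) auto

lemma local_order_mult:
  assumes "local_order f z m" "local_order g z n"
  shows "local_order (\<lambda>t. f t * g t) z (m + n)"
proof -
  obtain u where u: "u analytic_on {z}" "u z \<noteq> 0" "\<forall>\<^sub>F t in at z. f t = u t * (t - z) powi m"
    using assms unfolding local_order_def by blast
  obtain v where v: "v analytic_on {z}" "v z \<noteq> 0" "\<forall>\<^sub>F t in at z. g t = v t * (t - z) powi n"
    using assms unfolding local_order_def by blast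
  have "\<forall>\<^sub>F t in at z. t \<noteq> z" by (simp add: eventually_at_filter)
  then have "\<forall>\<^sub>F t in at z. f t * g t = (u t * v t) * (t - z) powi (m + n)"
    using u(3) v(3) by eventually_elim (simp add: power_int_add)
  moreover have "(\<lambda>t. u t * v t) analytic_on {z}" using u v by (intro analytic_intros)
  ultimately show ?thesis using u v unfolding local_order_def by (intro exI[of _ "\<lambda>t. u t * v t"]) auto
qed

lemma local_order_inverse:
  assumes "local_order f z m"
  shows "local_order (\<lambda>t. inverse (f t)) z (- m)"
proof -
  obtain u where u: "u analytic_on {z}" "u z \<noteq> 0" "\<forall>\<^sub>F t in at z. f t = u t * (t - z) powi m"
    using assms unfolding local_order_def by blast
  have "\<forall>\<^sub>F t in at z. inverse (f t) = inverse (u t) * (t - z) powi (- m)"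
    using u(3) by eventually_elim (simp add: power_int_minus)
  moreover have "(\<lambda>t. inverse (u t)) analytic_on {z}" using u by (intro analytic_intros) auto
  ultimately show ?thesis using u unfolding local_order_def by (intro exI[of _ "\<lambda>t. inverse (u t)"]) auto
qed

lemma local_order_divide:
  "local_order f z m \<Longrightarrow> local_order g z n \<Longrightarrow> local_order (\<lambda>t. f t / g t) z (m - n)"
  using local_order_mult[OF _ local_order_inverse, of f z m g n] by (simp add: divide_inverse)

lemma local_order_simple_zero:
  assumes "g analytic_on {z}" "g z = 0" "deriv g z \<noteq> 0"
  shows "local_order g z 1"
proof -
  obtain S where S: "open S" "z \<in> S" "g holomorphic_on S"
    using assms(1) analytic_at by blast
  obtain u r where u: "0 < r" "u holomorphic_on ball z r"
     "\<And>w. w \<in> ball z r \<Longrightarrow> g w - g z = (w - z) ^ 1 * u w" "\<And>w. w \<in> ball z r \<Longrightarrow> u w \<noteq> 0"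
    using holomorphic_factor_order_of_zero[OF S(3,1,2), of 1] assms(3) by (auto; metis)
  have "u analytic_on {z}" "u z \<noteq> 0"
    using u holomorphic_on_imp_analytic_at[OF u(2), of z] by auto
  moreover have "\<forall>\<^sub>F t in at z. t \<in> ball z r"
    using u(1) by (intro eventually_at_in_open') auto
  then have "\<forall>\<^sub>F t in at z. g t = u t * (t - z) powi 1"
    by eventually_elim (use u(3) assms(2) in \<open>simp add: mult.commute\<close>)
  ultimately show ?thesis unfolding local_order_def by blast
qed

section \<open>Points of the curve and tangent vectors\<close>

lemma UNIV_distinct_5:
  fixes i j k l m :: 5
  assumes "distinct [i, j, k, l, m]"
  shows "UNIV = {i, j, k, l, m}"
proof -
  have c: "card {i, j, k, l, m} = 5" using assms by simp
  have "card {i, j, k, l, m} = CARD(5)" unfolding c by simp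
  then show ?thesis
    by (intro card_subset_eq[symmetric]) auto
qed

lemma sum_distinct_5:
  fixes i j k l m :: 5
  assumes "distinct [i, j, k, l, m]"
  shows "sum f UNIV = f i + f j + f k + f l + f m"
  unfolding UNIV_distinct_5[OF assms] using assms by (simp add: add.assoc)

definition bring_vec :: "complex ^ 5 \<Rightarrow> bool" where
  "bring_vec x \<longleftrightarrow> (\<Sum>i\<in>UNIV. x $ i) = 0 \<and> (\<Sum>i\<in>UNIV. (x $ i) ^ 2) = 0 \<and> (\<Sum>i\<in>UNIV. (x $ i) ^ 3) = 0"

lemma bring_vec_iff:
  assumes "distinct [i, j, k, l, m]"
  shows "bring_vec x \<longleftrightarrow> bring_eqs (x $ i) (x $ j) (x $ k) (x $ l) (x $ m)"
  unfolding bring_vec_def bring_eqs_def sum_distinct_5[OF assms] ..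

definition kernel_vec :: "complex ^ 5 \<Rightarrow> complex ^ 5 \<Rightarrow> bool" where
  "kernel_vec x b \<longleftrightarrow> (\<Sum>i\<in>UNIV. b $ i) = 0 \<and> (\<Sum>i\<in>UNIV. x $ i * b $ i) = 0 \<and> (\<Sum>i\<in>UNIV. (x $ i) ^ 2 * b $ i) = 0"

lemma kernel_vec_iff:
  assumes "distinct [i, j, k, l, m]"
  shows "kernel_vec x b \<longleftrightarrow> kernel_eqs (x $ i) (x $ j) (x $ k) (x $ l) (x $ m) (b $ i) (b $ j) (b $ k) (b $ l) (b $ m)"
  unfolding kernel_vec_def kernel_eqs_def sum_distinct_5[OF assms] ..

lemma kernel_vec_self: "bring_vec x \<Longrightarrow> kernel_vec x x"
  unfolding bring_vec_def kernel_vec_def by (simp add: power2_eq_square power3_eq_cube mult.assoc)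

lemma vec5_eq_iff:
  fixes x y :: "complex ^ 5"
  assumes "distinct [i, j, k, l, m]"
  shows "x = y \<longleftrightarrow> x $ i = y $ i \<and> x $ j = y $ j \<and> x $ k = y $ k \<and> x $ l = y $ l \<and> x $ m = y $ m"
proof -
  have "x = y \<longleftrightarrow> (\<forall>a\<in>UNIV. x $ a = y $ a)" unfolding vec_eq_iff by simp
  then show ?thesis unfolding UNIV_distinct_5[OF assms] by simp
qed

lemma kernel_eqs_diff:
  assumes "kernel_eqs x1 x2 x3 x4 x5 b1 b2 b3 b4 b5" "kernel_eqs x1 x2 x3 x4 x5 a1 a2 a3 a4 a5"
  shows "kernel_eqs x1 x2 x3 x4 x5 (b1 - c * a1) (b2 - c * a2) (b3 - c * a3) (b4 - c * a4) (b5 - c * a5)"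
  using assms unfolding kernel_eqs_def by (intro conjI; algebra)

text \<open>If the minor vanished, some \<open>b - c x\<close> would be a nonzero kernel vector whose entries \<open>i\<close> and \<open>j\<close>
  are zero; but the three remaining entries satisfy a regular homogeneous Vandermonde system.\<close>

lemma kernel_vec_minor:
  assumes d: "distinct [i, j, k, l, m]" and x: "bring_vec x" and b: "kernel_vec x b"
    and v: "vand3 (x $ k) (x $ l) (x $ m) \<noteq> 0" and ind: "\<And>c. b \<noteq> c *s x"
  shows "x $ i * b $ j \<noteq> x $ j * b $ i"
proof
  assume eq: "x $ i * b $ j = x $ j * b $ i"
  have "\<not> (x $ i = 0 \<and> x $ j = 0)"
  proof
    assume "x $ i = 0 \<and> x $ j = 0"
    then have "bring_eqs 0 0 (x $ k) (x $ l) (x $ m)" using x bring_vec_iff[OF d] by simp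
    from bring_eqs_two_zero[OF this] v show False by (simp add: vand3_def)
  qed
  then obtain c where c: "b $ i = c * x $ i" "b $ j = c * x $ j"
  proof (cases "x $ i = 0")
    case True
    then have "x $ j \<noteq> 0" "b $ i = 0" using eq \<open>\<not> (x $ i = 0 \<and> x $ j = 0)\<close> by auto
    then show ?thesis using True by (intro that[of "b $ j / x $ j"]) auto
  next
    case False
    then show ?thesis using eq by (intro that[of "b $ i / x $ i"]) (auto simp: field_simps)
  qed
  have "kernel_eqs (x $ i) (x $ j) (x $ k) (x $ l) (x $ m) 0 0 (b $ k - c * x $ k) (b $ l - c * x $ l) (b $ m - c * x $ m)"
    using kernel_eqs_diff[OF b[unfolded kernel_vec_iff[OF d]] kernel_vec_self[OF x, unfolded kernel_vec_iff[OF d]], of c] c by simp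
  from kernel_zero[OF this v] have "b = c *s x"
    unfolding vec5_eq_iff[OF d] using c by simp
  then show False using ind by blast
qed

lemma proj_scale: "c \<noteq> 0 \<Longrightarrow> proj (c *s x) = proj x"
proof -
  assume c: "c \<noteq> 0"
  have "{d *s (c *s x) | d. d \<noteq> 0} = {d *s x | d. d \<noteq> 0}"
  proof (intro set_eqI iffI)
    fix y assume "y \<in> {d *s (c *s x) | d. d \<noteq> 0}"
    then obtain d where "d \<noteq> 0" "y = (d * c) *s x" by auto
    then show "y \<in> {d *s x | d. d \<noteq> 0}" using c by (intro CollectI exI[of _ "d * c"]) simp
  next
    fix y assume "y \<in> {d *s x | d. d \<noteq> 0}"
    then obtain d where "d \<noteq> 0" "y = d *s x" by auto
    then have "y = (d / c) *s (c *s x) \<and> d / c \<noteq> 0" using c by simp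
    then show "y \<in> {d *s (c *s x) | d. d \<noteq> 0}" by blast
  qed
  then show ?thesis unfolding proj_def .
qed

lemma self_in_proj: "x \<in> proj x"
proof -
  have "\<exists>c. x = c *s x \<and> c \<noteq> 0" by (intro exI[of _ 1]) simp
  then show ?thesis unfolding proj_def by simp
qed

lemma proj_eq_iff: "proj x = proj y \<longleftrightarrow> (\<exists>c. c \<noteq> 0 \<and> x = c *s y)"
proof
  assume "proj x = proj y"
  then have "x \<in> proj y" using self_in_proj[of x] by simp
  then show "\<exists>c. c \<noteq> 0 \<and> x = c *s y" unfolding proj_def by auto
next
  assume "\<exists>c. c \<noteq> 0 \<and> x = c *s y"
  then obtain c where "c \<noteq> 0" "x = c *s y" by blast
  then show "proj x = proj y" by (simp add: proj_scale)
qed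

lemma bring_vec_scale: "bring_vec x \<Longrightarrow> bring_vec (c *s x)"
  unfolding bring_vec_def vector_smult_component power_mult_distrib
    sum_distrib_left[of c, symmetric] sum_distrib_left[of "c ^ 2", symmetric] sum_distrib_left[of "c ^ 3", symmetric]
  by simp

lemma bring_curve_eq: "bring_curve = proj ` {x. x \<noteq> 0 \<and> bring_vec x}"
  unfolding bring_curve_def bring_vec_def by blast

lemma proj_in_bring_curve: 
  assumes "x \<noteq> 0"
  shows "proj x \<in> bring_curve \<longleftrightarrow> bring_vec x"
proof
  assume "proj x \<in> bring_curve"
  then obtain y where y: "bring_vec y" "proj x = proj y" unfolding bring_curve_eq by blast
  then obtain c where "x = c *s y" using proj_eq_iff by blast
  then show "bring_vec x" using bring_vec_scale[OF y(1)] by simp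
next
  assume "bring_vec x"
  then show "proj x \<in> bring_curve" using assms unfolding bring_curve_eq by blast
qed

section \<open>Local lifts and the residue factor\<close>

definition minor :: "(complex \<Rightarrow> complex ^ 'n) \<Rightarrow> 'n \<Rightarrow> 'n \<Rightarrow> complex \<Rightarrow> complex" where
  "minor w i j t = w t $ i * deriv (\<lambda>s. w s $ j) t - w t $ j * deriv (\<lambda>s. w s $ i) t"

text \<open>The factor \<open>\<phi>\<close> by which the Vandermonde determinants differ from the minors of \<open>w\<close> and \<open>w'\<close>.
  Where both quotients are defined they agree, by \<open>kernel_minors\<close>.\<close>

definition residue_factor :: "(complex \<Rightarrow> complex ^ 5) \<Rightarrow> complex \<Rightarrow> complex" where
  "residue_factor w t =
     (if vand3 (w t $ 1) (w t $ 2) (w t $ 3) \<noteq> 0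
      then minor w 4 5 t / vand3 (w t $ 1) (w t $ 2) (w t $ 3)
      else minor w 2 3 t / vand3 (w t $ 1) (w t $ 4) (w t $ 5))"

text \<open>A local lift of an immersed piece of the curve to the cone over it.\<close>

locale bring_lift =
  fixes S :: "complex set" and w :: "complex \<Rightarrow> complex ^ 5"
  assumes open_S: "open S"
    and holo: "\<And>i. (\<lambda>t. w t $ i) holomorphic_on S"
    and nonzero: "\<And>t. t \<in> S \<Longrightarrow> w t \<noteq> 0"
    and on_curve: "\<And>t. t \<in> S \<Longrightarrow> bring_vec (w t)"
    and immersion: "\<And>t. t \<in> S \<Longrightarrow> \<exists>i j. minor w i j t \<noteq> 0"
begin

lemma analytic: "t \<in> S \<Longrightarrow> (\<lambda>t. w t $ i) analytic_on {t}"
  using holomorphic_on_imp_analytic_at[OF holo open_S] .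

lemma has_deriv: "t \<in> S \<Longrightarrow> ((\<lambda>t. w t $ i) has_field_derivative deriv (\<lambda>s. w s $ i) t) (at t)"
  using holomorphic_derivI[OF holo open_S] .

definition w' where "w' t = (\<chi> i. deriv (\<lambda>s. w s $ i) t)"

lemma minor_w': "minor w i j t = w t $ i * w' t $ j - w t $ j * w' t $ i"
  unfolding minor_def w'_def by simp

lemma power_sum_deriv:
  assumes "t \<in> S" "\<And>t. t \<in> S \<Longrightarrow> (\<Sum>i\<in>UNIV. (w t $ i) ^ Suc n) = 0"
  shows "(\<Sum>i\<in>UNIV. (w t $ i) ^ n * w' t $ i) = 0"
proof -
  have "((\<lambda>t. \<Sum>i\<in>UNIV. (w t $ i) ^ Suc n) has_field_derivative
          (\<Sum>i\<in>UNIV. of_nat (Suc n) * (deriv (\<lambda>s. w s $ i) t * (w t $ i) ^ (Suc n - Suc 0)))) (at t)"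
    by (intro DERIV_sum DERIV_power has_deriv assms(1))
  then have "((\<lambda>_. 0) has_field_derivative
          (\<Sum>i\<in>UNIV. of_nat (Suc n) * (deriv (\<lambda>s. w s $ i) t * (w t $ i) ^ (Suc n - Suc 0)))) (at t)"
    by (rule has_field_derivative_transform_within_open[OF _ open_S assms(1)]) (rule assms(2))
  from DERIV_unique[OF this DERIV_const]
  have "of_nat (Suc n) * (\<Sum>i\<in>UNIV. deriv (\<lambda>s. w s $ i) t * (w t $ i) ^ n) = 0"
    unfolding sum_distrib_left by simp
  then have "(\<Sum>i\<in>UNIV. deriv (\<lambda>s. w s $ i) t * (w t $ i) ^ n) = 0"
    using of_nat_neq_0[of n, where 'a = complex] by (simp del: of_nat_Suc)
  then show ?thesis unfolding w'_def by (simp add: mult.commute)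
qed

lemma kernel: assumes "t \<in> S" shows "kernel_vec (w t) (w' t)"
  using power_sum_deriv[OF assms, of 0] power_sum_deriv[OF assms, of 1] power_sum_deriv[OF assms, of 2] on_curve
  unfolding kernel_vec_def bring_vec_def by (simp add: eval_nat_numeral)

lemma independent: assumes "t \<in> S" shows "w' t \<noteq> c *s w t"
proof
  assume "w' t = c *s w t"
  then have "minor w i j t = 0" for i j unfolding minor_w' by simp
  then show False using immersion[OF assms] by blast
qed

lemma minor_nonzero:
  assumes "t \<in> S" "distinct [i, j, k, l, m]" "vand3 (w t $ k) (w t $ l) (w t $ m) \<noteq> 0"
  shows "minor w i j t \<noteq> 0"
  using kernel_vec_minor[OF assms(2) on_curve[OF assms(1)] kernel[OF assms(1)] assms(3) independent[OF assms(1)]]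
  unfolding minor_w' by simp

lemma vand3_cases:
  assumes "t \<in> S"
  shows "vand3 (w t $ 1) (w t $ 2) (w t $ 3) \<noteq> 0 \<or> vand3 (w t $ 1) (w t $ 4) (w t $ 5) \<noteq> 0"
proof -
  have d: "distinct [1, 2, 3, 4, 5 :: 5]" by simp
  show ?thesis
    using bring_eqs_vand3 on_curve[OF assms] nonzero[OF assms] 
    unfolding bring_vec_iff[OF d] vec5_eq_iff[OF d] by simp
qed

lemma residue_factor_eqs:
  assumes "t \<in> S"
  shows "vand3 (w t $ 1) (w t $ 2) (w t $ 3) \<noteq> 0 \<Longrightarrow> residue_factor w t = minor w 4 5 t / vand3 (w t $ 1) (w t $ 2) (w t $ 3)"
    "vand3 (w t $ 1) (w t $ 4) (w t $ 5) \<noteq> 0 \<Longrightarrow> residue_factor w t = minor w 2 3 t / vand3 (w t $ 1) (w t $ 4) (w t $ 5)"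
proof -
  have d: "distinct [1, 2, 3, 4, 5 :: 5]" by simp
  have "minor w 4 5 t * vand3 (w t $ 1) (w t $ 4) (w t $ 5) = minor w 2 3 t * vand3 (w t $ 1) (w t $ 2) (w t $ 3)"
    using kernel_minors[OF kernel_vec_self[OF on_curve[OF assms], unfolded kernel_vec_iff[OF d]]
       kernel[OF assms, unfolded kernel_vec_iff[OF d]]]
    unfolding minor_w' .
  then show "vand3 (w t $ 1) (w t $ 4) (w t $ 5) \<noteq> 0 \<Longrightarrow> residue_factor w t = minor w 2 3 t / vand3 (w t $ 1) (w t $ 4) (w t $ 5)"
    unfolding residue_factor_def by (simp add: frac_eq_eq)
  show "vand3 (w t $ 1) (w t $ 2) (w t $ 3) \<noteq> 0 \<Longrightarrow> residue_factor w t = minor w 4 5 t / vand3 (w t $ 1) (w t $ 2) (w t $ 3)"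
    unfolding residue_factor_def by simp
qed

lemma residue_factor_nonzero:
  assumes "t \<in> S" shows "residue_factor w t \<noteq> 0"
  using vand3_cases[OF assms] residue_factor_eqs[OF assms] minor_nonzero[OF assms, of 4 5 1 2 3]
    minor_nonzero[OF assms, of 2 3 1 4 5] by auto

lemma minor_holo: "minor w i j holomorphic_on S"
  unfolding minor_def[abs_def] by (intro holomorphic_intros holo open_S)

lemma vand3_holo: "(\<lambda>t. vand3 (w t $ i) (w t $ j) (w t $ k)) holomorphic_on S"
  unfolding vand3_def by (intro holomorphic_intros holo)

lemma residue_factor_analytic:
  assumes "t \<in> S" shows "residue_factor w analytic_on {t}"
proof -
  have near: "\<forall>\<^sub>F s in nhds t. vand3 (w s $ i) (w s $ j) (w s $ k) \<noteq> 0 \<and> s \<in> S" 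
    if "vand3 (w t $ i) (w t $ j) (w t $ k) \<noteq> 0" for i j k
  proof -
    have "(\<lambda>t. vand3 (w t $ i) (w t $ j) (w t $ k)) analytic_on {t}"
      using holomorphic_on_imp_analytic_at[OF vand3_holo open_S assms] .
    then have "\<forall>\<^sub>F s in nhds t. vand3 (w s $ i) (w s $ j) (w s $ k) \<noteq> 0"
      using analytic_at_neq_imp_eventually_neq that by (auto simp: eventually_nhds_conv_at)
    moreover have "\<forall>\<^sub>F s in nhds t. s \<in> S" using open_S assms by (rule eventually_nhds_in_open)
    ultimately show ?thesis by eventually_elim simp
  qed
  have quot: "(\<lambda>s. minor w i' j' s / vand3 (w s $ i) (w s $ j) (w s $ k)) analytic_on {t}"
    if "vand3 (w t $ i) (w t $ j) (w t $ k) \<noteq> 0" for i' j' i j k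
    using that holomorphic_on_imp_analytic_at[OF vand3_holo open_S assms]
      holomorphic_on_imp_analytic_at[OF minor_holo open_S assms]
    by (intro analytic_on_divide) auto
  from vand3_cases[OF assms] show ?thesis
  proof
    assume v: "vand3 (w t $ 1) (w t $ 2) (w t $ 3) \<noteq> 0"
    have "\<forall>\<^sub>F s in nhds t. residue_factor w s = minor w 4 5 s / vand3 (w s $ 1) (w s $ 2) (w s $ 3)"
      using near[OF v] by eventually_elim (use residue_factor_eqs in blast)
    from analytic_at_cong[OF this refl] quot[OF v, of 4 5] show ?thesis by blast
  next
    assume v: "vand3 (w t $ 1) (w t $ 4) (w t $ 5) \<noteq> 0"
    have "\<forall>\<^sub>F s in nhds t. residue_factor w s = minor w 2 3 s / vand3 (w s $ 1) (w s $ 4) (w s $ 5)"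
      using near[OF v] by eventually_elim (use residue_factor_eqs in blast)
    from analytic_at_cong[OF this refl] quot[OF v, of 2 3] show ?thesis by blast
  qed
qed

end

section \<open>Comparison of two lifts\<close>

text \<open>The implicit function theorem in the form in which it is used: a continuous solution \<open>s\<close> of
  \<open>h(s(t)) = k(t)\<close> with differentiable \<open>k\<close> is differentiable wherever \<open>h\<close> has a nonzero derivative.\<close>

lemma has_field_derivative_continuous_factor:
  fixes h s :: "complex \<Rightarrow> complex"
  assumes h: "(h has_field_derivative h') (at (s t0))" "h' \<noteq> 0" and s: "isCont s t0"
    and hs: "((\<lambda>t. h (s t)) has_field_derivative D) (at t0)"
  shows "(s has_field_derivative D / h') (at t0)"
proof -
  obtain g where g: "\<And>z. h z - h (s t0) = g z * (z - s t0)" "isCont g (s t0)" "g (s t0) = h'"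
    using h(1) unfolding CARAT_DERIV by blast
  have gs: "((\<lambda>t. g (s t)) \<longlongrightarrow> h') (at t0)"
    using isCont_o2[OF s g(2)] unfolding isCont_def g(3) .
  then have "\<forall>\<^sub>F t in at t0. g (s t) \<noteq> 0" using h(2) by (rule tendsto_imp_eventually_ne)
  then have ev: "\<forall>\<^sub>F t in at t0. ((h (s t) - h (s t0)) / (t - t0)) / g (s t) = (s t - s t0) / (t - t0)"
    by eventually_elim (simp add: g(1))
  have "((\<lambda>t. (h (s t) - h (s t0)) / (t - t0)) \<longlongrightarrow> D) (at t0)"
    using hs unfolding has_field_derivative_iff .
  from tendsto_divide[OF this gs h(2)]
  have "((\<lambda>t. ((h (s t) - h (s t0)) / (t - t0)) / g (s t)) \<longlongrightarrow> D / h') (at t0)" .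
  then show ?thesis unfolding has_field_derivative_iff
    by (rule Lim_transform_eventually) (rule ev)
qed

lemma minor_swap: "minor w i j t = - minor w j i t"
  unfolding minor_def by simp

text \<open>A ratio \<open>h\<close> of two coordinates is a local parameter for the lift \<open>v\<close>, and it takes the same value
  on \<open>w\<close>. So a continuous change of parameter \<open>s\<close> satisfies the hypotheses of the preceding
  lemma.\<close>

lemma lift_transition_differentiable:
  assumes w: "bring_lift S w" and v: "bring_lift T v" and t0: "t0 \<in> S" and s0: "s t0 \<in> T" and s: "isCont s t0"
    and eq: "\<forall>\<^sub>F t in nhds t0. \<exists>c. c \<noteq> 0 \<and> w t = c *s v (s t)"
  shows "s field_differentiable (at t0)"
proof -
  interpret w: bring_lift S w by fact
  interpret v: bring_lift T v by fact
  obtain i j where ij: "minor v i j (s t0) \<noteq> 0" "v (s t0) $ j \<noteq> 0"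
  proof -
    obtain i j where ij: "minor v i j (s t0) \<noteq> 0" using v.immersion[OF s0] by blast
    then have "v (s t0) $ i \<noteq> 0 \<or> v (s t0) $ j \<noteq> 0" unfolding minor_def by auto
    then show ?thesis using that[of i j] that[of j i] ij minor_swap[of v i j] by auto
  qed
  define h where "h z = v z $ i / v z $ j" for z
  define h' where "h' = (deriv (\<lambda>s. v s $ i) (s t0) * v (s t0) $ j - v (s t0) $ i * deriv (\<lambda>s. v s $ j) (s t0)) / (v (s t0) $ j * v (s t0) $ j)"
  have h: "(h has_field_derivative h') (at (s t0))"
    unfolding h_def[abs_def] h'_def by (rule DERIV_divide[OF v.has_deriv[OF s0] v.has_deriv[OF s0] ij(2)])
  have h0: "h' \<noteq> 0" using ij unfolding h'_def minor_def by (simp add: algebra_simps)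
  obtain c where c: "c \<noteq> 0" "w t0 = c *s v (s t0)" using eventually_nhds_x_imp_x[OF eq] by blast
  have "(\<lambda>t. w t $ i / w t $ j) field_differentiable (at t0)"
    using c ij(2) t0 w.has_deriv[OF t0] by (intro field_differentiable_divide) (auto simp: field_differentiable_def)
  then obtain D where D: "((\<lambda>t. w t $ i / w t $ j) has_field_derivative D) (at t0)"
    unfolding field_differentiable_def by blast
  have hs: "\<forall>\<^sub>F t in nhds t0. w t $ i / w t $ j = h (s t)"
    using eq by eventually_elim (auto simp: h_def)
  have "((\<lambda>t. h (s t)) has_field_derivative D) (at t0)"
    using D by (rule has_field_derivative_cong_eventually[THEN iffD1, rotated -1])
     (use hs in \<open>auto simp: eventually_nhds_conv_at\<close>)
  from has_field_derivative_continuous_factor[OF h h0 s this] show ?thesis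
    unfolding field_differentiable_def by blast
qed

text \<open>The 2 by 2 determinants formed from the proportional vectors \<open>w(t)\<close> and \<open>v(s(t))\<close> vanish identically; their derivative at \<open>t0\<close> is the
  claim.\<close>

lemma lift_transition_minor:
  assumes w: "bring_lift S w" and v: "bring_lift T v" and t0: "t0 \<in> S" and s0: "s t0 \<in> T" and s: "isCont s t0"
    and eq: "\<forall>\<^sub>F t in nhds t0. \<exists>c. c \<noteq> 0 \<and> w t = c *s v (s t)" and c: "w t0 = c *s v (s t0)"
  shows "minor w i j t0 = c^2 * deriv s t0 * minor v i j (s t0)"
proof -
  interpret w: bring_lift S w by fact
  interpret v: bring_lift T v by fact
  have D: "(s has_field_derivative deriv s t0) (at t0)"
    using lift_transition_differentiable[OF assms(1-6)] field_differentiable_derivI by blast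
  have vs: "((\<lambda>t. v (s t) $ k) has_field_derivative deriv (\<lambda>s. v s $ k) (s t0) * deriv s t0) (at t0)" for k
    using DERIV_chain2[OF v.has_deriv[OF s0] D] .
  let ?E = "deriv (\<lambda>t. w t $ i) t0 * v (s t0) $ j + (deriv (\<lambda>s. v s $ j) (s t0) * deriv s t0) * w t0 $ i
     - (deriv (\<lambda>t. w t $ j) t0 * v (s t0) $ i + (deriv (\<lambda>s. v s $ i) (s t0) * deriv s t0) * w t0 $ j)"
  have "((\<lambda>t. w t $ i * v (s t) $ j - w t $ j * v (s t) $ i) has_field_derivative ?E) (at t0)"
    by (intro DERIV_diff DERIV_mult w.has_deriv t0 vs)
  moreover have "\<forall>\<^sub>F t in nhds t0. w t $ i * v (s t) $ j - w t $ j * v (s t) $ i = 0"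
    using eq by eventually_elim auto
  ultimately have "((\<lambda>t. 0) has_field_derivative ?E) (at t0)"
    by (subst (asm) has_field_derivative_cong_eventually[where g = "\<lambda>_. 0"]) (auto simp: eventually_nhds_conv_at)
  from DERIV_unique[OF this DERIV_const] have E: "?E = 0" .
  have k: "w t0 $ k = c * v (s t0) $ k" for k using c by simp
  show ?thesis using E k[of i] k[of j] unfolding minor_def by algebra
qed

lemma vand3_scale: "vand3 (c * x) (c * y) (c * z) = c^3 * vand3 x y z"
  unfolding vand3_def by algebra

text \<open>The minors scale with \<open>c\<^sup>2\<close> and the Vandermonde determinants with \<open>c\<^sup>3\<close>.\<close>

lemma residue_factor_transition:
  assumes w: "bring_lift S w" and v: "bring_lift T v" and t0: "t0 \<in> S" and s0: "s t0 \<in> T" and s: "isCont s t0"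
    and eq: "\<forall>\<^sub>F t in nhds t0. \<exists>c. c \<noteq> 0 \<and> w t = c *s v (s t)" and c: "w t0 = c *s v (s t0)" and "c \<noteq> 0"
  shows "c * residue_factor w t0 = deriv s t0 * residue_factor v (s t0)"
  using \<open>c \<noteq> 0\<close> lift_transition_minor[OF assms(1-7)] 
  unfolding residue_factor_def by (simp add: c vand3_scale field_simps power2_eq_square power3_eq_cube)

section \<open>The topology of projective space\<close>

lemma topspace_proj_topology: "topspace proj_topology = (proj_space :: (complex ^ 'n) set set)"
proof (rule antisym)
  show "topspace proj_topology \<subseteq> (proj_space :: (complex ^ 'n) set set)"
    using openin_topspace openin_proj_topology by blast
  have "{v :: complex ^ 'n. v \<noteq> 0 \<and> proj v \<in> proj_space} = - {0}" unfolding proj_space_def by auto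
  then have "openin proj_topology (proj_space :: (complex ^ 'n) set set)"
    unfolding openin_proj_topology using open_Compl[OF closed_singleton[of "0 :: complex ^ 'n"]] by simp
  then show "(proj_space :: (complex ^ 'n) set set) \<subseteq> topspace proj_topology" by (rule openin_subset)
qed

text \<open>A choice of homogeneous coordinates; expressions of degree 0 in it do not depend on the choice.\<close>

definition representative :: "(complex ^ 'n) set \<Rightarrow> complex ^ 'n" where
  "representative p = (SOME v. v \<in> p)"

lemma representative_proj:
  obtains c where "c \<noteq> 0" "representative (proj x) = c *s x"
proof -
  have "representative (proj x) \<in> proj x" 
    unfolding representative_def using self_in_proj by (rule someI)
  then show ?thesis using that unfolding proj_def by blast
qed

text \<open>The open subsets of projective space, as sets of nonzero vectors.\<close>

definition cone_open :: "(complex ^ 'n) set \<Rightarrow> bool" where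
  "cone_open N \<longleftrightarrow> open N \<and> 0 \<notin> N \<and> (\<forall>v c. c \<noteq> 0 \<longrightarrow> v \<in> N \<longrightarrow> c *s v \<in> N)"

lemma cone_open_proj_iff: "cone_open N \<Longrightarrow> proj v \<in> proj ` N \<longleftrightarrow> v \<in> N"
proof
  assume N: "cone_open N" and "proj v \<in> proj ` N"
  then obtain x where x: "x \<in> N" "proj v = proj x" by blast
  then obtain c where "c \<noteq> 0" "v = c *s x" using proj_eq_iff by blast
  then show "v \<in> N" using N x(1) unfolding cone_open_def by blast
qed blast

lemma openin_proj_cone: 
  assumes "cone_open N" shows "openin proj_topology (proj ` N)"
proof -
  have "{v. v \<noteq> 0 \<and> proj v \<in> proj ` N} = N"
    using cone_open_proj_iff[OF assms] assms unfolding cone_open_def by auto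
  moreover have "proj ` N \<subseteq> proj_space" using assms unfolding proj_space_def cone_open_def by auto
  ultimately show ?thesis using assms unfolding openin_proj_topology cone_open_def by simp
qed

lemma continuous_map_from_proj:
  fixes z :: "(complex ^ 'n) set \<Rightarrow> complex"
  assumes N: "cone_open N" and U: "U \<subseteq> proj ` N" and z: "continuous_on N (\<lambda>v. z (proj v))" and S: "z ` U \<subseteq> S"
  shows "continuous_map (subtopology proj_topology U) (top_of_set S) z"
proof -
  have "continuous_map (subtopology proj_topology U) euclidean z"
    unfolding continuous_map_def
  proof (intro conjI allI impI)
    fix V :: "complex set" assume "openin euclidean V"
    then have V: "open V" by simp
    let ?M = "{v \<in> N. z (proj v) \<in> V}"
    have "cone_open ?M"
      unfolding cone_open_def
    proof (intro conjI allI impI)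
      show "open ?M"
        using continuous_open_preimage[OF z _ V] N unfolding cone_open_def 
        by (simp add: vimage_def Int_def conj_commute)
      show "0 \<notin> ?M" using N unfolding cone_open_def by simp
      fix v and c :: complex assume "c \<noteq> 0" "v \<in> ?M"
      then show "c *s v \<in> ?M" using N unfolding cone_open_def by (simp add: proj_scale)
    qed
    then have "openin proj_topology (proj ` ?M)" by (rule openin_proj_cone)
    moreover have "{x \<in> topspace (subtopology proj_topology U). z x \<in> V} = proj ` ?M \<inter> U"
      using U openin_subset[OF openin_proj_cone[OF N]] unfolding topspace_subtopology by auto
    ultimately show "openin (subtopology proj_topology U) {x \<in> topspace (subtopology proj_topology U). z x \<in> V}"
      unfolding openin_subtopology by blast
  qed simp
  then show ?thesis
    unfolding continuous_map_in_subtopology using S by auto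
qed

lemma continuous_map_into_proj:
  fixes w :: "complex \<Rightarrow> complex ^ 'n"
  assumes w: "continuous_on S w" "\<And>t. t \<in> S \<Longrightarrow> w t \<noteq> 0" and S: "open S" and U: "(proj \<circ> w) ` S \<subseteq> U"
  shows "continuous_map (top_of_set S) (subtopology proj_topology U) (proj \<circ> w)"
proof -
  have "continuous_map (top_of_set S) proj_topology (proj \<circ> w)"
    unfolding continuous_map_def
  proof (intro conjI allI impI)
    show "proj \<circ> w \<in> topspace (top_of_set S) \<rightarrow> topspace proj_topology"
      using w(2) unfolding topspace_proj_topology proj_space_def by auto
    fix V :: "(complex ^ 'n) set set" assume V: "openin proj_topology V"
    then have "open {v. v \<noteq> 0 \<and> proj v \<in> V}" unfolding openin_proj_topology by blast
    from continuous_open_preimage[OF w(1) S this]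
    have "open (S \<inter> w -` {v. v \<noteq> 0 \<and> proj v \<in> V})" .
    moreover have "{x \<in> topspace (top_of_set S). (proj \<circ> w) x \<in> V} = S \<inter> w -` {v. v \<noteq> 0 \<and> proj v \<in> V}"
      using w(2) by auto
    ultimately show "openin (top_of_set S) {x \<in> topspace (top_of_set S). (proj \<circ> w) x \<in> V}"
      using S by (simp add: openin_open_eq)
  qed
  then show ?thesis unfolding continuous_map_in_subtopology using U by auto
qed

section \<open>Charts and changes of coordinates\<close>

lemma bring_curve_subset: "bring_curve \<subseteq> proj_space"
  unfolding bring_curve_eq proj_space_def by blast

lemma atlas_domain_subset:
  assumes "c \<in> curve_atlas X" shows "fst c \<subseteq> X" "fst c \<subseteq> proj_space"
proof -
  have "openin (subtopology proj_topology X) (fst c)" using assms unfolding curve_atlas_def by blast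
  from openin_subset[OF this] show "fst c \<subseteq> X" "fst c \<subseteq> proj_space"
    unfolding topspace_subtopology topspace_proj_topology by auto
qed

lemma atlas_inj: assumes "c \<in> curve_atlas X" shows "inj_on (snd c) (fst c)"
proof -
  have "homeomorphic_map (subtopology proj_topology (fst c)) (top_of_set (chart_range c)) (snd c)"
    using assms unfolding curve_atlas_def by blast
  then show ?thesis using atlas_domain_subset[OF assms]
    unfolding homeomorphic_map_def topspace_subtopology topspace_proj_topology by (simp add: Int_absorb1)
qed

lemma atlas_continuous:
  assumes "c \<in> curve_atlas X"
  shows "continuous_map (subtopology proj_topology (fst c)) (top_of_set (chart_range c)) (snd c)"
    "continuous_map (top_of_set (chart_range c)) (subtopology proj_topology (fst c)) (chart_inv c)"
proof -
  have h: "homeomorphic_map (subtopology proj_topology (fst c)) (top_of_set (chart_range c)) (snd c)"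
    using assms unfolding curve_atlas_def by blast
  then obtain g where g: "homeomorphic_maps (subtopology proj_topology (fst c)) (top_of_set (chart_range c)) (snd c) g"
    unfolding homeomorphic_map_maps by blast
  then show "continuous_map (subtopology proj_topology (fst c)) (top_of_set (chart_range c)) (snd c)"
    unfolding homeomorphic_maps_def by blast
  have gc: "continuous_map (top_of_set (chart_range c)) (subtopology proj_topology (fst c)) g"
    using g unfolding homeomorphic_maps_def by blast
  then have "g t \<in> fst c" if "t \<in> chart_range c" for t
    using that unfolding continuous_map_in_subtopology by auto
  moreover have "snd c (g t) = t" if "t \<in> chart_range c" for t
    using g that unfolding homeomorphic_maps_def by auto
  ultimately have "chart_inv c t = g t" if "t \<in> chart_range c" for t
    using that atlas_inj[OF assms] by (intro inv_into_f_eq) auto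
  then show "continuous_map (top_of_set (chart_range c)) (subtopology proj_topology (fst c)) (chart_inv c)"
    using gc by (rule_tac continuous_map_eq) auto
qed

lemma atlas_open_range: "c \<in> curve_atlas X \<Longrightarrow> open (chart_range c)"
  unfolding curve_atlas_def by blast

lemma transition_continuous:
  assumes c: "c \<in> curve_atlas X" and d: "d \<in> curve_atlas X" and p: "p \<in> fst c" "p \<in> fst d"
  shows "isCont (snd d \<circ> chart_inv c) (snd c p)" "\<forall>\<^sub>F t in nhds (snd c p). t \<in> chart_range c \<and> chart_inv c t \<in> fst d"
proof -
  define V where "V = {t \<in> chart_range c. chart_inv c t \<in> fst d}"
  obtain T where T: "openin proj_topology T" "fst d = T \<inter> X"
    using d unfolding curve_atlas_def openin_subtopology by blast
  have cc: "continuous_map (top_of_set (chart_range c)) proj_topology (chart_inv c)"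
    using atlas_continuous(2)[OF c] unfolding continuous_map_in_subtopology by blast
  have "openin (top_of_set (chart_range c)) {t \<in> topspace (top_of_set (chart_range c)). chart_inv c t \<in> T}"
    using openin_continuous_map_preimage[OF cc T(1)] .
  moreover have "{t \<in> topspace (top_of_set (chart_range c)). chart_inv c t \<in> T} = V"
    using atlas_domain_subset(1)[OF c] unfolding V_def T(2) by (auto simp: inv_into_into)
  ultimately have V: "open V"
    using atlas_open_range[OF c] by (metis openin_open_eq)
  have "V \<subseteq> chart_range c" unfolding V_def by blast
  then have "continuous_map (top_of_set V) proj_topology (chart_inv c)"
    using continuous_map_from_subtopology_mono[OF cc] by blast
  then have "continuous_map (top_of_set V) (subtopology proj_topology (fst d)) (chart_inv c)"
    unfolding continuous_map_in_subtopology V_def by auto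
  from continuous_map_compose[OF this atlas_continuous(1)[OF d]]
  have "continuous_map (top_of_set V) (top_of_set (chart_range d)) (snd d \<circ> chart_inv c)" .
  then have co: "continuous_on V (snd d \<circ> chart_inv c)"
    unfolding continuous_map_in_subtopology by (simp add: continuous_map_iff_continuous)
  have pV: "snd c p \<in> V" unfolding V_def using p by (simp add: inv_into_f_f[OF atlas_inj[OF c]])
  show "isCont (snd d \<circ> chart_inv c) (snd c p)" using co V pV continuous_on_eq_continuous_at by blast
  have "\<forall>\<^sub>F t in nhds (snd c p). t \<in> V" using V pV by (rule eventually_nhds_in_open)
  then show "\<forall>\<^sub>F t in nhds (snd c p). t \<in> chart_range c \<and> chart_inv c t \<in> fst d"
    unfolding V_def by eventually_elim simp
qed

lemma atlas_lift:
  assumes c: "c \<in> curve_atlas bring_curve"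
  shows "\<exists>w. bring_lift (chart_range c) w \<and> (\<forall>t\<in>chart_range c. chart_inv c t = proj (w t))"
proof -
  obtain w where w: "\<And>i. (\<lambda>t. w t $ i) holomorphic_on chart_range c"
     "\<And>t. t \<in> chart_range c \<Longrightarrow> w t \<noteq> 0"
     "\<And>t. t \<in> chart_range c \<Longrightarrow> chart_inv c t = proj (w t)"
     "\<And>t. t \<in> chart_range c \<Longrightarrow> \<exists>i j. w t $ i * deriv (\<lambda>s. w s $ j) t \<noteq> w t $ j * deriv (\<lambda>s. w s $ i) t"
    using c unfolding curve_atlas_def by blast
  have "bring_lift (chart_range c) w"
  proof
    show "open (chart_range c)" using atlas_open_range[OF c] .
    fix t assume t: "t \<in> chart_range c"
    have "chart_inv c t \<in> bring_curve" 
      using atlas_domain_subset(1)[OF c] inv_into_into[OF t] by (rule subsetD)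
    then show "bring_vec (w t)" using w(2,3)[OF t] proj_in_bring_curve by simp
    show "\<exists>i j. minor w i j t \<noteq> 0" using w(4)[OF t] unfolding minor_def by (metis right_minus_eq)
  qed (use w in auto)
  then show ?thesis using w(3) by (intro exI[of _ w] conjI ballI)
qed

section \<open>Existence of charts\<close>

text \<open>For a point of the curve with \<open>x\<^sub>i = t\<close> and \<open>x\<^sub>j = 1\<close> this polynomial in \<open>z\<close> has the three other
  coordinates as its roots.\<close>

definition fibre_cubic :: "complex \<Rightarrow> complex \<Rightarrow> complex" where
  "fibre_cubic t z = z^3 + (t + 1) * z^2 + (t^2 + t + 1) * z + (t^3 + t^2 + t + 1)"

lemma bring_eqs_symmetric:
  assumes "bring_eqs t 1 a b c"
  shows "a + b + c = - (t + 1)" "a * b + b * c + c * a = t^2 + t + 1" "a * b * c = - (t^3 + t^2 + t + 1)"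
proof -
  show 1: "a + b + c = - (t + 1)" using assms unfolding bring_eqs_def by algebra
  have p: "a^2 + b^2 + c^2 = - (t^2 + 1)" "a^3 + b^3 + c^3 = - (t^3 + 1)"
    using assms unfolding bring_eqs_def power_one by algebra+
  show 2: "a * b + b * c + c * a = t^2 + t + 1" using p(1) 1 by algebra
  show "a * b * c = - (t^3 + t^2 + t + 1)" using p(2) 1 2 by algebra
qed

lemma bring_eqs_of_symmetric:
  assumes "a + b + c = - (t + 1)" "a * b + b * c + c * a = t^2 + t + 1" "a * b * c = - (t^3 + t^2 + t + 1)"
  shows "bring_eqs t 1 a b c"
  unfolding bring_eqs_def power_one using assms by (intro conjI; algebra)

lemma fibre_cubic_eq: "bring_eqs t 1 a b c \<Longrightarrow> fibre_cubic t z = (z - a) * (z - b) * (z - c)"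
  using bring_eqs_symmetric[of t a b c] unfolding fibre_cubic_def by algebra

lemma bring_eqs_fibre_exists: "\<exists>a b c. bring_eqs t 1 a b c"
proof -
  obtain a where "(\<Sum>i\<le>3. [t^3 + t^2 + t + 1, t^2 + t + 1, t + 1, 1] ! i * a ^ i) = 0"
    by (rule fundamental_theorem_of_algebra[of "\<lambda>i. [t^3 + t^2 + t + 1, t^2 + t + 1, t + 1, 1] ! i" 3])
      (auto intro!: bexI[of _ 3])
  then have a: "a^3 + (t + 1) * a^2 + (t^2 + t + 1) * a + (t^3 + t^2 + t + 1) = 0"
    by (simp add: eval_nat_numeral algebra_simps)
  define p where "p = a + t + 1"
  define q where "q = a^2 + (t + 1) * a + t^2 + t + 1"
  define d where "d = csqrt (p^2 - 4 * q)"
  have d: "d^2 = p^2 - 4 * q" unfolding d_def by simp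
  define b where "b = (d - p) / 2"
  define c where "c = (- d - p) / 2"
  have s: "b + c = - p" unfolding b_def c_def by (simp add: field_simps)
  have m: "b * c = q" using d unfolding b_def c_def by (simp add: field_simps power2_eq_square)
  have "bring_eqs t 1 a b c"
    using s m a unfolding p_def q_def by (intro bring_eqs_of_symmetric; algebra)
  then show ?thesis by blast
qed

definition separated :: "real \<Rightarrow> complex \<Rightarrow> complex \<Rightarrow> complex \<Rightarrow> bool" where
  "separated \<delta> a b c \<longleftrightarrow> 2 * \<delta> \<le> dist a b \<and> 2 * \<delta> \<le> dist b c \<and> 2 * \<delta> \<le> dist a c"

lemma separated_disjoint:
  assumes "separated \<delta> a b c"
  shows "\<not> (dist z a < \<delta> \<and> dist z b < \<delta>)" "\<not> (dist z b < \<delta> \<and> dist z c < \<delta>)" "\<not> (dist z a < \<delta> \<and> dist z c < \<delta>)"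
  using assms dist_triangle2[of a b z] dist_triangle2[of b c z] dist_triangle2[of a c z]
  unfolding separated_def by (auto simp: dist_commute)

lemma separated_exists:
  assumes "vand3 a b c \<noteq> 0" "\<eta> > 0"
  obtains \<delta> where "\<delta> > 0" "\<delta> \<le> \<eta>" "separated \<delta> a b c"
proof -
  have ne: "a \<noteq> b" "b \<noteq> c" "a \<noteq> c" using assms unfolding vand3_def by auto
  show ?thesis
    by (rule that[of "min \<eta> (min (dist a b / 2) (min (dist b c / 2) (dist a c / 2)))"])
      (use ne assms(2) in \<open>auto simp: separated_def min_def\<close>)
qed

lemma fibre_unique:
  assumes sep: "separated \<delta> a0 b0 c0"
    and "bring_eqs t 1 a b c" "dist a a0 < \<delta>" "dist b b0 < \<delta>" "dist c c0 < \<delta>"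
    and "bring_eqs t 1 a' b' c'" "dist a' a0 < \<delta>" "dist b' b0 < \<delta>" "dist c' c0 < \<delta>"
  shows "a' = a \<and> b' = b \<and> c' = c"
proof -
  have "(a', b', c') \<in> {(a,b,c), (a,c,b), (b,a,c), (b,c,a), (c,a,b), (c,b,a)}"
    using bring_eqs_symmetric[OF assms(2)] bring_eqs_symmetric[OF assms(6)]
    by (intro triple_eq_perm) simp_all
  then show ?thesis using separated_disjoint[OF sep] assms(3-5) assms(7-9) by auto
qed

text \<open>If no root of the cubic at the parameter \<open>t\<close> were within \<open>\<delta>\<close> of the old root \<open>z\<close>, then the
  value of the cubic at \<open>z\<close> would be at least \<open>\<delta>\<^sup>3\<close>; but it is small. So each of the three disjoint discs
  around the old roots contains one of the three new roots.\<close>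

lemma fibre_near:
  assumes e: "bring_eqs t0 1 a0 b0 c0" and v: "vand3 a0 b0 c0 \<noteq> 0" and "\<eta> > 0"
  shows "\<forall>\<^sub>F t in nhds t0. \<exists>a b c. bring_eqs t 1 a b c \<and> dist a a0 < \<eta> \<and> dist b b0 < \<eta> \<and> dist c c0 < \<eta>"
proof -
  obtain \<delta> where \<delta>: "\<delta> > 0" "\<delta> \<le> \<eta>" "separated \<delta> a0 b0 c0" by (rule separated_exists[OF v \<open>\<eta> > 0\<close>])
  have small: "\<forall>\<^sub>F t in nhds t0. norm (fibre_cubic t z) < \<delta>^3" if "fibre_cubic t0 z = 0" for z
  proof -
    have "isCont (\<lambda>t. norm (fibre_cubic t z)) t0" unfolding fibre_cubic_def by (intro continuous_intros)
    then have "\<forall>\<^sub>F t in at t0. norm (fibre_cubic t z) < \<delta>^3"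
      unfolding isCont_def by (rule order_tendstoD) (use that \<delta>(1) in simp)
    then show ?thesis using that \<delta>(1) by (simp add: eventually_nhds_conv_at)
  qed
  have near: "dist a z < \<delta> \<or> dist b z < \<delta> \<or> dist c z < \<delta>"
    if "bring_eqs t 1 a b c" "norm (fibre_cubic t z) < \<delta>^3" for t z a b c
  proof (rule ccontr)
    assume "\<not> ?thesis"
    then have n: "\<delta> \<le> norm (z - a)" "\<delta> \<le> norm (z - b)" "\<delta> \<le> norm (z - c)"
      by (auto simp: dist_norm norm_minus_commute)
    have "\<delta> * \<delta> * \<delta> \<le> norm (z - a) * norm (z - b) * norm (z - c)"
      using n \<delta>(1) by (intro mult_mono) auto
    also have "\<dots> = norm (fibre_cubic t z)" unfolding fibre_cubic_eq[OF that(1)] norm_mult ..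
    finally show False using that(2) by (simp add: power3_eq_cube)
  qed
  have "\<forall>\<^sub>F t in nhds t0. norm (fibre_cubic t a0) < \<delta>^3 \<and> norm (fibre_cubic t b0) < \<delta>^3 \<and> norm (fibre_cubic t c0) < \<delta>^3"
    by (intro eventually_conj small) (simp_all add: fibre_cubic_eq[OF e])
  then show ?thesis
  proof eventually_elim
    case (elim t)
    obtain a b c where abc: "bring_eqs t 1 a b c" using bring_eqs_fibre_exists by blast
    have perm: "bring_eqs t 1 a c b" "bring_eqs t 1 b a c" "bring_eqs t 1 b c a" "bring_eqs t 1 c a b" "bring_eqs t 1 c b a"
      using abc unfolding bring_eqs_def by (simp_all add: algebra_simps)
    consider "dist a a0 < \<delta>" "dist b b0 < \<delta>" "dist c c0 < \<delta>"
      | "dist a a0 < \<delta>" "dist c b0 < \<delta>" "dist b c0 < \<delta>"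
      | "dist b a0 < \<delta>" "dist a b0 < \<delta>" "dist c c0 < \<delta>"
      | "dist b a0 < \<delta>" "dist c b0 < \<delta>" "dist a c0 < \<delta>"
      | "dist c a0 < \<delta>" "dist a b0 < \<delta>" "dist b c0 < \<delta>"
      | "dist c a0 < \<delta>" "dist b b0 < \<delta>" "dist a c0 < \<delta>"
      using near[OF abc, of a0] near[OF abc, of b0] near[OF abc, of c0] elim
        separated_disjoint[OF \<delta>(3), of a] separated_disjoint[OF \<delta>(3), of b] separated_disjoint[OF \<delta>(3), of c]
      by argo
    then have "\<exists>a b c. bring_eqs t 1 a b c \<and> dist a a0 < \<delta> \<and> dist b b0 < \<delta> \<and> dist c c0 < \<delta>"
      by cases (use abc perm in blast)+
    then show ?case using \<delta>(2) by (meson less_le_trans)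
  qed
qed

text \<open>The root \<open>s(t1)\<close> is simple, and the cubics for \<open>t\<close> and \<open>t1\<close> differ by a multiple of \<open>t - t1\<close>.\<close>

lemma fibre_root_differentiable:
  assumes e: "\<forall>\<^sub>F t in nhds t1. bring_eqs t 1 (s t) (s2 t) (s3 t)"
    and v: "vand3 (s t1) (s2 t1) (s3 t1) \<noteq> 0" and s: "isCont s t1"
  shows "s field_differentiable (at t1)"
proof -
  define h where "h = fibre_cubic t1"
  have e1: "bring_eqs t1 1 (s t1) (s2 t1) (s3 t1)" using eventually_nhds_x_imp_x[OF e] .
  have h1: "h (s t1) = 0" unfolding h_def fibre_cubic_eq[OF e1] by simp
  have h: "(h has_field_derivative (s t1 - s2 t1) * (s t1 - s3 t1)) (at (s t1))"
    unfolding CARAT_DERIV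
  proof (intro exI conjI allI)
    show "h z - h (s t1) = ((z - s2 t1) * (z - s3 t1)) * (z - s t1)" for z
      unfolding h1 unfolding h_def fibre_cubic_eq[OF e1] by simp
  qed (auto intro!: continuous_intros)
  have h0: "(s t1 - s2 t1) * (s t1 - s3 t1) \<noteq> 0" using v unfolding vand3_def by auto
  \<comment> \<open>The quotient of the difference of the cubics for \<open>t1\<close> and \<open>t\<close> by \<open>t - t1\<close>, at \<open>s t\<close>.\<close>
  define K where "K t = - ((s t)^2 + (t1 + t + 1) * s t + (t1^2 + t1 * t + t^2 + t1 + t + 1))" for t
  have "isCont K t1" unfolding K_def using s by (intro continuous_intros)
  then have "((\<lambda>t. K t * (t - t1)) has_field_derivative K t1) (at t1)"
    unfolding CARAT_DERIV by (intro exI[of _ K]) auto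
  moreover have "\<forall>\<^sub>F t in nhds t1. K t * (t - t1) = h (s t)"
    using e
  proof eventually_elim
    case (elim t)
    have "fibre_cubic t (s t) = 0" using fibre_cubic_eq[OF elim] by simp
    then show ?case unfolding K_def h_def fibre_cubic_def by algebra
  qed
  ultimately have "((\<lambda>t. h (s t)) has_field_derivative K t1) (at t1)"
    by (subst (asm) has_field_derivative_cong_eventually[where g = "\<lambda>t. h (s t)"]) (auto simp: eventually_nhds_conv_at)
  from has_field_derivative_continuous_factor[OF h h0 s this] show ?thesis
    unfolding field_differentiable_def by blast
qed

text \<open>Each of the disjoint discs contains one root, so no choice is involved in the branches. This makes them
  continuous, by \<open>fibre_near\<close> for smaller discs, and hence holomorphic.\<close>

lemma fibre_branches:
  assumes e: "bring_eqs t0 1 a0 b0 c0" and v: "vand3 a0 b0 c0 \<noteq> 0"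
  obtains \<epsilon> \<delta> r1 r2 r3 where "\<epsilon> > 0" "\<delta> > 0"
    "r1 holomorphic_on ball t0 \<epsilon>" "r2 holomorphic_on ball t0 \<epsilon>" "r3 holomorphic_on ball t0 \<epsilon>"
    "\<And>t. t \<in> ball t0 \<epsilon> \<Longrightarrow> bring_eqs t 1 (r1 t) (r2 t) (r3 t) \<and> dist (r1 t) a0 < \<delta> \<and> dist (r2 t) b0 < \<delta> \<and> dist (r3 t) c0 < \<delta>"
    "\<And>t a b c. t \<in> ball t0 \<epsilon> \<Longrightarrow> bring_eqs t 1 a b c \<Longrightarrow> dist a a0 < \<delta> \<Longrightarrow> dist b b0 < \<delta> \<Longrightarrow> dist c c0 < \<delta>
       \<Longrightarrow> a = r1 t \<and> b = r2 t \<and> c = r3 t"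
proof -
  obtain \<delta> where \<delta>: "\<delta> > 0" "separated \<delta> a0 b0 c0" by (rule separated_exists[OF v zero_less_one])
  obtain \<epsilon> where \<epsilon>: "\<epsilon> > 0"
    "\<And>t. dist t t0 < \<epsilon> \<Longrightarrow> \<exists>a b c. bring_eqs t 1 a b c \<and> dist a a0 < \<delta> \<and> dist b b0 < \<delta> \<and> dist c c0 < \<delta>"
    using fibre_near[OF e v \<delta>(1)] unfolding eventually_nhds_metric by blast
  let ?P = "\<lambda>t r. bring_eqs t 1 (fst r) (fst (snd r)) (snd (snd r))
    \<and> dist (fst r) a0 < \<delta> \<and> dist (fst (snd r)) b0 < \<delta> \<and> dist (snd (snd r)) c0 < \<delta>"
  have "\<exists>r. ?P t r" if "t \<in> ball t0 \<epsilon>" for t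
    using \<epsilon>(2)[of t] that by (auto simp: dist_commute)
  then obtain r where r: "\<forall>t\<in>ball t0 \<epsilon>. ?P t (r t)"
    using bchoice[of "ball t0 \<epsilon>" ?P] by blast
  define r1 where "r1 t = fst (r t)" for t
  define r2 where "r2 t = fst (snd (r t))" for t
  define r3 where "r3 t = snd (snd (r t))" for t
  have R: "bring_eqs t 1 (r1 t) (r2 t) (r3 t) \<and> dist (r1 t) a0 < \<delta> \<and> dist (r2 t) b0 < \<delta> \<and> dist (r3 t) c0 < \<delta>"
    if "t \<in> ball t0 \<epsilon>" for t
    using r that unfolding r1_def r2_def r3_def by blast
  have unique: "a = r1 t \<and> b = r2 t \<and> c = r3 t"
    if "t \<in> ball t0 \<epsilon>" "bring_eqs t 1 a b c" "dist a a0 < \<delta>" "dist b b0 < \<delta>" "dist c c0 < \<delta>" for t a b c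
    using fibre_unique[OF \<delta>(2)] R[OF that(1)] that(2-5) by blast
  have vt: "vand3 (r1 t) (r2 t) (r3 t) \<noteq> 0" if "t \<in> ball t0 \<epsilon>" for t
    using R[OF that] separated_disjoint[OF \<delta>(2)] unfolding vand3_def by auto
  have cont: "\<forall>\<^sub>F t in nhds t1. dist (r1 t) (r1 t1) < \<eta> \<and> dist (r2 t) (r2 t1) < \<eta> \<and> dist (r3 t) (r3 t1) < \<eta>"
    if t1: "t1 \<in> ball t0 \<epsilon>" and "\<eta> > 0" for t1 \<eta>
  proof -
    \<comment> \<open>Roots that are closer than this to the branches at \<open>t1\<close> still lie in the isolating discs.\<close>
    define \<eta>' where "\<eta>' = Min {\<eta>, \<delta> - dist (r1 t1) a0, \<delta> - dist (r2 t1) b0, \<delta> - dist (r3 t1) c0}"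
    have \<eta>': "\<eta>' > 0" "\<eta>' \<le> \<eta>" "\<eta>' \<le> \<delta> - dist (r1 t1) a0" "\<eta>' \<le> \<delta> - dist (r2 t1) b0" "\<eta>' \<le> \<delta> - dist (r3 t1) c0"
      unfolding \<eta>'_def using R[OF t1] \<open>\<eta> > 0\<close> by auto
    have "\<forall>\<^sub>F t in nhds t1. t \<in> ball t0 \<epsilon>" using t1 by (intro eventually_nhds_in_open) auto
    moreover have "\<forall>\<^sub>F t in nhds t1. \<exists>a b c. bring_eqs t 1 a b c \<and> dist a (r1 t1) < \<eta>' \<and> dist b (r2 t1) < \<eta>' \<and> dist c (r3 t1) < \<eta>'"
      using fibre_near[OF _ vt[OF t1] \<eta>'(1)] R[OF t1] by blast
    ultimately show ?thesis
    proof eventually_elim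
      case (elim t)
      then obtain a b c where abc: "bring_eqs t 1 a b c" "dist a (r1 t1) < \<eta>'" "dist b (r2 t1) < \<eta>'" "dist c (r3 t1) < \<eta>'"
        by blast
      have "dist a a0 < \<delta>" "dist b b0 < \<delta>" "dist c c0 < \<delta>"
        using abc \<eta>' dist_triangle[of a a0 "r1 t1"] dist_triangle[of b b0 "r2 t1"] dist_triangle[of c c0 "r3 t1"] by linarith+
      then have "a = r1 t \<and> b = r2 t \<and> c = r3 t" using unique elim(1) abc(1) by blast
      then show ?case using abc \<eta>'(2) by auto
    qed
  qed
  have isCont: "isCont r1 t1 \<and> isCont r2 t1 \<and> isCont r3 t1" if "t1 \<in> ball t0 \<epsilon>" for t1
    using cont[OF that] unfolding isCont_def tendsto_iff eventually_nhds_conv_at eventually_conj_iff by blast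
  have near: "\<forall>\<^sub>F t in nhds t1. bring_eqs t 1 (r1 t) (r2 t) (r3 t)" if "t1 \<in> ball t0 \<epsilon>" for t1
  proof -
    have "\<forall>\<^sub>F t in nhds t1. t \<in> ball t0 \<epsilon>" using that by (intro eventually_nhds_in_open) auto
    then show ?thesis by eventually_elim (use R in blast)
  qed
  have "r1 field_differentiable (at t1) \<and> r2 field_differentiable (at t1) \<and> r3 field_differentiable (at t1)"
    if t1: "t1 \<in> ball t0 \<epsilon>" for t1
  proof (intro conjI)
    have v: "vand3 (r1 t1) (r2 t1) (r3 t1) \<noteq> 0" "vand3 (r2 t1) (r1 t1) (r3 t1) \<noteq> 0" "vand3 (r3 t1) (r1 t1) (r2 t1) \<noteq> 0"
      using vt[OF t1] unfolding vand3_def by auto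
    have n: "\<forall>\<^sub>F t in nhds t1. bring_eqs t 1 (r2 t) (r1 t) (r3 t)" "\<forall>\<^sub>F t in nhds t1. bring_eqs t 1 (r3 t) (r1 t) (r2 t)"
      using near[OF t1] by (eventually_elim, simp add: bring_eqs_def algebra_simps)+
    show "r1 field_differentiable (at t1)" "r2 field_differentiable (at t1)" "r3 field_differentiable (at t1)"
      using fibre_root_differentiable[OF near[OF t1] v(1)] fibre_root_differentiable[OF n(1) v(2)]
        fibre_root_differentiable[OF n(2) v(3)] isCont[OF t1] by blast+
  qed
  then have "r1 holomorphic_on ball t0 \<epsilon>" "r2 holomorphic_on ball t0 \<epsilon>" "r3 holomorphic_on ball t0 \<epsilon>"
    unfolding holomorphic_on_def by (blast intro: field_differentiable_at_within)+
  from that[OF \<epsilon>(1) \<delta>(1) this R unique] show ?thesis .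
qed

lemma cone_open_polydisc:
  fixes i j k l m :: "'n::finite"
  assumes "\<epsilon> > 0" "\<delta> > 0"
  shows "cone_open {v :: complex ^ 'n. norm (v $ i - t0 * v $ j) < \<epsilon> * norm (v $ j)
      \<and> norm (v $ k - a0 * v $ j) < \<delta> * norm (v $ j) \<and> norm (v $ l - b0 * v $ j) < \<delta> * norm (v $ j)
      \<and> norm (v $ m - c0 * v $ j) < \<delta> * norm (v $ j)}" (is "cone_open ?N")
  unfolding cone_open_def
proof (intro conjI allI impI)
  show "open ?N"
    by (intro open_Collect_conj open_Collect_less continuous_intros)
  show "0 \<notin> ?N" by simp
  have scale: "norm (c * x - b * (c * y)) < e * norm (c * y) \<longleftrightarrow> norm (x - b * y) < e * norm y"
    if "c \<noteq> 0" for b c x y :: complex and e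
  proof -
    have "c * x - b * (c * y) = c * (x - b * y)" by (simp add: algebra_simps)
    moreover have "e * norm (c * y) = norm c * (e * norm y)" by (simp add: norm_mult)
    ultimately show ?thesis using that by (simp only: norm_mult) simp
  qed
  fix v and c :: complex assume "c \<noteq> 0" "v \<in> ?N"
  then show "c *s v \<in> ?N"
    unfolding mem_Collect_eq vector_smult_component scale[OF \<open>c \<noteq> 0\<close>] by blast
qed

lemma ratio_representative: "representative (proj v) $ i / representative (proj v) $ j = v $ i / v $ j"
proof -
  obtain c where "c \<noteq> 0" "representative (proj v) = c *s v" by (rule representative_proj)
  then show ?thesis by simp
qed

lemma norm_ratio_less:
  fixes x y b :: complex
  assumes "norm (x - b * y) < e * norm y" "y \<noteq> 0"
  shows "dist (x / y) b < e"
proof -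
  have "x / y - b = (x - b * y) / y" using assms(2) by (simp add: field_simps)
  then show ?thesis using assms by (simp add: dist_norm norm_divide divide_less_eq)
qed

text \<open>The coordinate is \<open>x\<^sub>i / x\<^sub>j\<close>, on the open part of the curve where the three other ratios lie in
  the discs that isolate the branches; its inverse is the lift \<open>w\<close> consisting of the parameter, 1 and
  the three branches.\<close>

lemma chart_at_normalized_point:
  fixes x :: "complex ^ 5"
  assumes d: "distinct [i, j, k, l, m]" and x: "bring_vec x" "x $ j = 1" and v: "vand3 (x $ k) (x $ l) (x $ m) \<noteq> 0"
  shows "\<exists>c\<in>curve_atlas bring_curve. proj x \<in> fst c"
proof -
  have e0: "bring_eqs (x $ i) 1 (x $ k) (x $ l) (x $ m)" using x bring_vec_iff[OF d] by simp
  obtain \<epsilon> \<delta> r1 r2 r3 where pos: "\<epsilon> > 0" "\<delta> > 0"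
    and holo: "r1 holomorphic_on ball (x $ i) \<epsilon>" "r2 holomorphic_on ball (x $ i) \<epsilon>" "r3 holomorphic_on ball (x $ i) \<epsilon>"
    and r: "\<And>t. t \<in> ball (x $ i) \<epsilon> \<Longrightarrow> bring_eqs t 1 (r1 t) (r2 t) (r3 t) \<and> dist (r1 t) (x $ k) < \<delta>
        \<and> dist (r2 t) (x $ l) < \<delta> \<and> dist (r3 t) (x $ m) < \<delta>"
    and unique: "\<And>t a b c. t \<in> ball (x $ i) \<epsilon> \<Longrightarrow> bring_eqs t 1 a b c \<Longrightarrow> dist a (x $ k) < \<delta> \<Longrightarrow> dist b (x $ l) < \<delta>
       \<Longrightarrow> dist c (x $ m) < \<delta> \<Longrightarrow> a = r1 t \<and> b = r2 t \<and> c = r3 t"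
    using fibre_branches[OF e0 v] by blast
  define S where "S = ball (x $ i) \<epsilon>"
  define N where "N = {v :: complex ^ 5. norm (v $ i - x $ i * v $ j) < \<epsilon> * norm (v $ j)
      \<and> norm (v $ k - x $ k * v $ j) < \<delta> * norm (v $ j) \<and> norm (v $ l - x $ l * v $ j) < \<delta> * norm (v $ j)
      \<and> norm (v $ m - x $ m * v $ j) < \<delta> * norm (v $ j)}"
  define w :: "complex \<Rightarrow> complex ^ 5" where
    "w t = (\<chi> n. if n = i then t else if n = j then 1 else if n = k then r1 t else if n = l then r2 t else r3 t)" for t
  define z where "z p = representative p $ i / representative p $ j" for p :: "(complex ^ 5) set"
  define U where "U = proj ` N \<inter> bring_curve"
  have w: "w t $ i = t" "w t $ j = 1" "w t $ k = r1 t" "w t $ l = r2 t" "w t $ m = r3 t" for t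
    using d unfolding w_def by auto
  have N: "cone_open N" unfolding N_def by (rule cone_open_polydisc[OF pos])
  have Nj: "v $ j \<noteq> 0" if "v \<in> N" for v using that unfolding N_def by auto
  have w0: "w t \<noteq> 0" for t using w(2)[of t] by (metis zero_index zero_neq_one)
  have zp: "z (proj v) = v $ i / v $ j" for v unfolding z_def by (rule ratio_representative)
  have wN: "w t \<in> N" if "t \<in> S" for t
    using r[of t] that unfolding N_def S_def by (simp add: w dist_norm norm_minus_commute)
  have wU: "proj (w t) \<in> U" if "t \<in> S" for t
    using wN[OF that] r[of t] that proj_in_bring_curve[OF w0] bring_vec_iff[OF d]
    unfolding U_def S_def by (simp add: w)
  have zw: "z (proj (w t)) = t" for t unfolding zp w by simp
  have wz: "z p \<in> S \<and> proj (w (z p)) = p" if pU: "p \<in> U" for p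
  proof -
    obtain v where v: "v \<in> N" "p = proj v" using pU unfolding U_def by blast
    have vj: "v $ j \<noteq> 0" using Nj[OF v(1)] .
    then have "v \<noteq> 0" by auto
    moreover have "proj v \<in> bring_curve" using pU v(2) unfolding U_def by simp
    ultimately have bv: "bring_vec v" using proj_in_bring_curve by simp
    \<comment> \<open>The normalized representative lies in the isolating discs, so uniqueness of the branches applies.\<close>
    define u where "u = inverse (v $ j) *s v"
    have u: "p = proj u" "bring_vec u" "u $ n = v $ n / v $ j" for n
      using vj bring_vec_scale[OF bv] unfolding u_def v(2) by (simp_all add: proj_scale divide_inverse mult.commute)
    have du: "dist (u $ i) (x $ i) < \<epsilon>" "dist (u $ k) (x $ k) < \<delta>" "dist (u $ l) (x $ l) < \<delta>" "dist (u $ m) (x $ m) < \<delta>"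
      using v(1) vj unfolding N_def u(3) by (auto intro: norm_ratio_less)
    have uj: "u $ j = 1" using vj unfolding u(3) by simp
    have "bring_eqs (u $ i) 1 (u $ k) (u $ l) (u $ m)" using u(2) uj bring_vec_iff[OF d] by simp
    moreover have uS: "u $ i \<in> S" using du(1) unfolding S_def by (simp add: dist_commute)
    ultimately have "u $ k = r1 (u $ i) \<and> u $ l = r2 (u $ i) \<and> u $ m = r3 (u $ i)"
      using unique du unfolding S_def by blast
    then have "u = w (u $ i)" unfolding vec5_eq_iff[OF d] by (simp add: w uj)
    moreover have "z p = u $ i" unfolding u(1) zp uj by simp
    ultimately show ?thesis using uS u(1) by simp
  qed
  have holo_w: "(\<lambda>t. w t $ n) holomorphic_on S" for n
  proof -
    have "n \<in> {i, j, k, l, m}" using UNIV_distinct_5[OF d] by blast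
    then consider "n = i" | "n = j" | "n = k" | "n = l" | "n = m" by blast
    then show ?thesis
    proof cases
    qed (use holo in \<open>simp_all add: w S_def\<close>)
  qed
  have cont_w: "continuous_on S w"
  proof -
    have "continuous_on S (\<lambda>t. \<chi> n. w t $ n)"
      by (intro continuous_on_vec_lambda holomorphic_on_imp_continuous_on holo_w)
    then show ?thesis by simp
  qed
  have zU: "z ` U = S"
  proof
    show "z ` U \<subseteq> S" using wz by blast
    show "S \<subseteq> z ` U"
    proof
      fix t assume "t \<in> S"
      then show "t \<in> z ` U" using wU zw by (intro image_eqI[of _ _ "proj (w t)"]) auto
    qed
  qed
  have "continuous_map (subtopology proj_topology U) (top_of_set S) z"
  proof (rule continuous_map_from_proj[OF N])
    show "U \<subseteq> proj ` N" unfolding U_def by blast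
    show "continuous_on N (\<lambda>v. z (proj v))" unfolding zp by (intro continuous_intros) (use Nj in auto)
  qed (use zU in blast)
  moreover have "continuous_map (top_of_set S) (subtopology proj_topology U) (proj \<circ> w)"
    using cont_w w0 wU by (intro continuous_map_into_proj) (auto simp: S_def)
  moreover have "U \<subseteq> proj_space" using bring_curve_subset unfolding U_def by blast
  then have tU: "topspace (subtopology proj_topology U) = U"
    unfolding topspace_subtopology topspace_proj_topology by blast
  ultimately have hm: "homeomorphic_maps (subtopology proj_topology U) (top_of_set S) z (proj \<circ> w)"
    unfolding homeomorphic_maps_def tU using wz zw by auto
  then have hz: "homeomorphic_map (subtopology proj_topology U) (top_of_set S) z"
    unfolding homeomorphic_map_maps by blast
  have inj: "inj_on z U" using wz by (metis inj_onI)
  have inv: "inv_into U z t = proj (w t)" if "t \<in> S" for t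
    by (rule inv_into_f_eq[OF inj wU[OF that] zw])
  have deriv_w: "deriv (\<lambda>s. w s $ i) t = 1" "deriv (\<lambda>s. w s $ j) t = 0" for t
    unfolding w by simp_all
  have "(U, z) \<in> curve_atlas bring_curve"
    unfolding curve_atlas_def mem_Collect_eq fst_conv snd_conv zU
  proof (intro conjI exI[of _ w] allI ballI)
    show "openin (subtopology proj_topology bring_curve) U"
      unfolding openin_subtopology U_def using openin_proj_cone[OF N] by blast
    show "open S" unfolding S_def by simp
    fix t assume t: "t \<in> S"
    show "inv_into U z t = proj (w t)" using inv[OF t] .
    show "\<exists>i j. w t $ i * deriv (\<lambda>s. w s $ j) t \<noteq> w t $ j * deriv (\<lambda>s. w s $ i) t"
      by (intro exI[of _ i] exI[of _ j]) (simp add: deriv_w w)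
  qed (use hz holo_w w0 in auto)
  moreover have "proj x \<in> U"
  proof -
    have "x \<noteq> 0" using x(2) by auto
    then have "proj x \<in> bring_curve" using x(1) proj_in_bring_curve by simp
    moreover have "x \<in> N" using x(2) pos unfolding N_def by simp
    ultimately show ?thesis unfolding U_def by blast
  qed
  ultimately show ?thesis by (intro bexI[of _ "(U, z)"]) simp_all
qed

text \<open>The complement of a triple with distinct entries contains a nonzero entry, by which the
  point is normalized.\<close>

lemma bring_curve_chart_exists:
  assumes "p \<in> bring_curve"
  shows "\<exists>c\<in>curve_atlas bring_curve. p \<in> fst c"
proof -
  obtain x where x: "x \<noteq> 0" "bring_vec x" "p = proj x" using assms unfolding bring_curve_eq by blast
  have D: "distinct [1, 2, 3, 4, 5 :: 5]" by simp
  have 1: ?thesis if d: "distinct [i, j, k, l, m]" and v: "vand3 (x $ k) (x $ l) (x $ m) \<noteq> 0" and j: "x $ j \<noteq> 0" for i j k l m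
  proof -
    let ?y = "inverse (x $ j) *s x"
    have "vand3 (?y $ k) (?y $ l) (?y $ m) \<noteq> 0" using v j by (simp add: vand3_scale)
    moreover have "bring_vec ?y" using bring_vec_scale[OF x(2)] .
    moreover have "?y $ j = 1" using j by simp
    ultimately have "\<exists>c\<in>curve_atlas bring_curve. proj ?y \<in> fst c"
      using chart_at_normalized_point[OF d] by blast
    then show ?thesis using j x(3) by (simp add: proj_scale)
  qed
  have 2: ?thesis if d: "distinct [i, j, k, l, m]" and v: "vand3 (x $ k) (x $ l) (x $ m) \<noteq> 0" for i j k l m
  proof -
    have "x $ i \<noteq> 0 \<or> x $ j \<noteq> 0"
    proof (rule ccontr)
      assume "\<not> ?thesis"
      then have "bring_eqs 0 0 (x $ k) (x $ l) (x $ m)" using x(2) bring_vec_iff[OF d] by simp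
      from bring_eqs_two_zero[OF this] v show False by (simp add: vand3_def)
    qed
    moreover have d': "distinct [j, i, k, l, m]" using d by auto
    ultimately show ?thesis using 1[OF d v] 1[OF d' v] by blast
  qed
  have "vand3 (x $ 1) (x $ 2) (x $ 3) \<noteq> 0 \<or> vand3 (x $ 1) (x $ 4) (x $ 5) \<noteq> 0"
    using bring_eqs_vand3 x(1,2) unfolding bring_vec_iff[OF D] vec5_eq_iff[OF D] by simp
  then show ?thesis using 2[of 4 5 1 2 3] 2[of 2 3 1 4 5] by auto
qed

section \<open>The two hyperplane sections\<close>

lemma local_order_pole:
  assumes "local_order g z n" "n < 0"
  shows "is_pole g z"
proof -
  obtain u where u: "u analytic_on {z}" "u z \<noteq> 0" "\<forall>\<^sub>F t in at z. g t = u t * (t - z) powi n"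
    using assms unfolding local_order_def by blast
  define k where "k = nat (- n)"
  have k: "k > 0" "n = - int k" using assms(2) unfolding k_def by auto
  have nz: "\<forall>\<^sub>F t in at z. t \<noteq> z" by (simp add: eventually_at_filter)
  have "((\<lambda>t. (t - z) ^ k) \<longlongrightarrow> (z - z) ^ k) (at z)" by (intro tendsto_intros)
  then have "filterlim (\<lambda>t. (t - z) ^ k) (at 0) (at z)"
    unfolding filterlim_at using k(1) nz by (auto simp: zero_power elim!: eventually_mono)
  then have pole: "is_pole (\<lambda>t. u t / (t - z) ^ k) z"
    using u(2) analytic_at_imp_isCont[OF u(1)] by (intro is_pole_divide)
  have "\<forall>\<^sub>F t in at z. g t = u t / (t - z) ^ k"
    using u(3) by eventually_elim (simp add: k(2) power_int_minus divide_inverse)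
  from is_pole_cong[OF this refl] pole show ?thesis by simp
qed

lemma local_order_meromorphic:
  assumes "local_order g z n"
  shows "g meromorphic_on {z}"
proof -
  obtain u where u: "u analytic_on {z}" "u z \<noteq> 0" "\<forall>\<^sub>F t in at z. g t = u t * (t - z) powi n"
    using assms unfolding local_order_def by blast
  have "(\<lambda>t. u t * (t - z) powi n) meromorphic_on {z}"
    using u(1) by (intro meromorphic_intros analytic_on_imp_meromorphic_on analytic_intros)
  then show ?thesis using u(3) by (subst meromorphic_on_cong[OF _ refl, of _ g "\<lambda>t. u t * (t - z) powi n"]) auto
qed

definition vec5 :: "complex \<Rightarrow> complex \<Rightarrow> complex \<Rightarrow> complex \<Rightarrow> complex \<Rightarrow> complex ^ 5" where
  "vec5 a b c d e = (\<chi> m. if m = 1 then a else if m = 2 then b else if m = 3 then c else if m = 4 then d else e)"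

lemma distinct_1_to_5: "distinct [1, 2, 3, 4, 5 :: 5]" by simp

lemma vec5_nth [simp]: "vec5 a b c d e $ 1 = a" "vec5 a b c d e $ 2 = b" "vec5 a b c d e $ 3 = c"
  "vec5 a b c d e $ 4 = d" "vec5 a b c d e $ 5 = e"
  unfolding vec5_def by simp_all

lemma vec5_eqI: "x $ 1 = a \<Longrightarrow> x $ 2 = b \<Longrightarrow> x $ 3 = c \<Longrightarrow> x $ 4 = d \<Longrightarrow> x $ 5 = e \<Longrightarrow> x = vec5 a b c d e"
  unfolding vec5_eq_iff[OF distinct_1_to_5] by simp

lemma proj_vec5_eq_1: "proj (vec5 a b c d 1) = proj (vec5 a' b' c' d' 1) \<longleftrightarrow> a = a' \<and> b = b' \<and> c = c' \<and> d = d'"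
proof
  assume "proj (vec5 a b c d 1) = proj (vec5 a' b' c' d' 1)"
  then obtain q where "vec5 a b c d 1 = q *s vec5 a' b' c' d' 1" using proj_eq_iff by blast
  then show "a = a' \<and> b = b' \<and> c = c' \<and> d = d'"
    unfolding vec5_eq_iff[OF distinct_1_to_5] by simp
qed simp

lemma proj_vec5_neq: "a \<noteq> b \<Longrightarrow> proj (vec5 a b c d e) \<noteq> proj (vec5 a' a' c' d' e')"
  unfolding proj_eq_iff vec5_eq_iff[OF distinct_1_to_5] by auto

lemma proj_eq_scaled_vec5:
  assumes "x \<noteq> 0" "x $ 1 = q * a" "x $ 2 = q * b" "x $ 3 = q * c" "x $ 4 = q * d" "x $ 5 = q * e"
  shows "q \<noteq> 0" "proj x = proj (vec5 a b c d e)"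
proof -
  have x: "x = q *s vec5 a b c d e" unfolding vec5_eq_iff[OF distinct_1_to_5] using assms by simp
  then show "q \<noteq> 0" using assms(1) by auto
  then show "proj x = proj (vec5 a b c d e)" unfolding x by (rule proj_scale)
qed

lemma vec5_on_curve: 
  assumes "bring_eqs a b c d e" "e \<noteq> 0"
  shows "proj (vec5 a b c d e) \<in> bring_curve"
proof -
  have "vec5 a b c d e $ 5 \<noteq> 0" using assms(2) by simp
  then have "vec5 a b c d e \<noteq> 0" by (metis zero_index)
  then show ?thesis using assms(1) by (simp add: proj_in_bring_curve bring_vec_iff[OF distinct_1_to_5])
qed

context bring_constants begin

definition tangent_form :: "complex ^ 5 \<Rightarrow> complex" where
  "tangent_form x = \<kappa> * x $ 3 + (\<gamma> * A - \<alpha>) * x $ 4 + (\<alpha> * B - \<beta> * A) * x $ 5"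

text \<open>In the adapted coordinates \<open>n, m, l\<close> of the plane, this form is \<open>n\<close>; it vanishes on the line through
  \<open>(A : B : 1)\<close> and \<open>(1 : 0 : 0)\<close>. Accordingly the next form is \<open>m\<close>, and the preceding one is \<open>l\<close>.\<close>

definition P_line_form :: "complex ^ 5 \<Rightarrow> complex" where
  "P_line_form x = x $ 4 - B * x $ 5"
definition W_line_form :: "complex ^ 5 \<Rightarrow> complex" where
  "W_line_form x = \<beta> * x $ 5 - \<gamma> * x $ 4"
definition conic_form :: "complex ^ 5 \<Rightarrow> complex" where
  "conic_form x = residual_conic (P_line_form x) (W_line_form x) (tangent_form x)"

definition "pt_W = proj (vec5 1 1 \<alpha> \<beta> \<gamma>)"
definition "pt_P = proj (vec5 \<delta>' \<delta> A B 1)"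
definition "pt_P' = proj (vec5 \<delta> \<delta>' A B 1)"
definition "pts_145_245 = {proj (vec5 A \<delta>' \<delta> B 1), proj (vec5 A \<delta> \<delta>' B 1), proj (vec5 \<delta>' A \<delta> B 1), proj (vec5 \<delta> A \<delta>' B 1)}"

definition tangent_mult :: "(complex ^ 5) set \<Rightarrow> int" where
  "tangent_mult p = (if p = pt_W then 4 else if p \<in> {pt_P, pt_P'} then 1 else 0)"
definition P_line_mult :: "(complex ^ 5) set \<Rightarrow> int" where
  "P_line_mult p = (if p \<in> {pt_P, pt_P'} \<union> pts_145_245 then 1 else 0)"

lemma forms_scale: "tangent_form (c *s x) = c * tangent_form x" "P_line_form (c *s x) = c * P_line_form x"
  "W_line_form (c *s x) = c * W_line_form x"
  unfolding tangent_form_def P_line_form_def W_line_form_def by (simp_all add: algebra_simps)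

lemma conic_scale: "conic_form (c *s x) = c^2 * conic_form x"
  unfolding conic_form_def forms_scale residual_conic_def plane_cubic_dx_def by algebra

lemma curve_identities:
  assumes "bring_vec x"
  shows "tangent_form x * conic_form x = (25/4) * \<sigma>^2 * P_line_form x * (W_line_form x)^2"
    "\<kappa>^2 * (x $ 1 - x $ 2)^2 = W_line_form x * (- 10 * \<sigma> * P_line_form x - (15/8) * \<sigma>^2 * W_line_form x)
       + tangent_form x * residual_line (P_line_form x) (W_line_form x) (tangent_form x)"
proof -
  have e: "bring_eqs (x $ 1) (x $ 2) (x $ 3) (x $ 4) (x $ 5)" using assms bring_vec_iff[OF distinct_1_to_5] by simp
  show "tangent_form x * conic_form x = (25/4) * \<sigma>^2 * P_line_form x * (W_line_form x)^2"
    using plane_cubic_coords(1)[of "x $ 3" "x $ 4" "x $ 5"] bring_eqs_imp_plane(1)[OF e]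
    unfolding conic_form_def tangent_form_def P_line_form_def W_line_form_def by simp
  show "\<kappa>^2 * (x $ 1 - x $ 2)^2 = W_line_form x * (- 10 * \<sigma> * P_line_form x - (15/8) * \<sigma>^2 * W_line_form x)
       + tangent_form x * residual_line (P_line_form x) (W_line_form x) (tangent_form x)"
    unfolding bring_eqs_imp_plane(2)[OF e] plane_cubic_coords(2)
    unfolding tangent_form_def P_line_form_def W_line_form_def ..
qed

lemma tangent_form_zero:
  assumes "bring_vec x" "x \<noteq> 0" "tangent_form x = 0"
  shows "(proj x = pt_W \<and> W_line_form x = 0 \<and> P_line_form x \<noteq> 0 \<and> x $ 1 = x $ 2 \<and> x $ 1 \<noteq> 0 \<and> conic_form x \<noteq> 0 \<and> vand3 (x $ 3) (x $ 4) (x $ 5) \<noteq> 0)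
     \<or> (proj x \<in> {pt_P, pt_P'} \<and> P_line_form x = 0 \<and> W_line_form x \<noteq> 0)"
proof -
  have e: "bring_eqs (x $ 1) (x $ 2) (x $ 3) (x $ 4) (x $ 5)" using assms bring_vec_iff[OF distinct_1_to_5] by simp
  obtain q where q: "(x $ 1, x $ 2, x $ 3, x $ 4, x $ 5) \<in> {(q, q, q * \<alpha>, q * \<beta>, q * \<gamma>),
           (q * \<delta>', q * \<delta>, q * A, q * B, q), (q * \<delta>, q * \<delta>', q * A, q * B, q)}"
    using tangent_zero[OF e] assms(3) unfolding tangent_form_def by blast
  then consider "x $ 1 = q" "x $ 2 = q" "x $ 3 = q * \<alpha>" "x $ 4 = q * \<beta>" "x $ 5 = q * \<gamma>"
    | "x $ 1 = q * \<delta>'" "x $ 2 = q * \<delta>" "x $ 3 = q * A" "x $ 4 = q * B" "x $ 5 = q"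
    | "x $ 1 = q * \<delta>" "x $ 2 = q * \<delta>'" "x $ 3 = q * A" "x $ 4 = q * B" "x $ 5 = q" by auto
  then show ?thesis
  proof cases
    case 1
    note p = proj_eq_scaled_vec5[OF assms(2), of q 1 1 \<alpha> \<beta> \<gamma>]
    have q0: "q \<noteq> 0" and pW: "proj x = pt_W" using p 1 unfolding pt_W_def by simp_all
    have a: "W_line_form x = 0" unfolding W_line_form_def 1 by simp
    have "P_line_form x = q * \<kappa>" unfolding P_line_form_def \<kappa>_def 1 by algebra
    then have c: "P_line_form x \<noteq> 0" using q0 kappa_nonzero by simp
    then have "conic_form x \<noteq> 0" unfolding conic_form_def a assms(3) residual_conic_at_W using W_not_one by simp
    moreover have "vand3 (x $ 3) (x $ 4) (x $ 5) \<noteq> 0" unfolding 1 vand3_scale using q0 W_distinct by (simp add: vand3_def)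
    ultimately show ?thesis using pW a c 1 q0 by simp
  next
    case 2
    note p = proj_eq_scaled_vec5[OF assms(2), of q \<delta>' \<delta> A B 1]
    have "W_line_form x = q * \<kappa>" unfolding W_line_form_def \<kappa>_def 2 by algebra
    then show ?thesis using p 2 kappa_nonzero unfolding pt_P_def P_line_form_def by simp
  next
    case 3
    note p = proj_eq_scaled_vec5[OF assms(2), of q \<delta> \<delta>' A B 1]
    have "W_line_form x = q * \<kappa>" unfolding W_line_form_def \<kappa>_def 3 by algebra
    then show ?thesis using p 3 kappa_nonzero unfolding pt_P'_def P_line_form_def by simp
  qed
qed

lemma P_line_form_zero:
  assumes "bring_vec x" "x \<noteq> 0" "P_line_form x = 0"
  shows "proj x \<in> {pt_P, pt_P'} \<union> pts_145_245" "vand3 (x $ 1) (x $ 2) (x $ 3) \<noteq> 0"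
proof -
  have e: "bring_eqs (x $ 1) (x $ 2) (x $ 3) (x $ 4) (x $ 5)" using assms bring_vec_iff[OF distinct_1_to_5] by simp
  define q where "q = x $ 5"
  have "x $ 4 = B * x $ 5" using assms(3) unfolding P_line_form_def by simp
  note z = P_line_zero[OF e this, folded q_def]
  have "\<exists>a b c. (a, b, c) \<in> {(A,\<delta>,\<delta>'), (A,\<delta>',\<delta>), (\<delta>,A,\<delta>'), (\<delta>,\<delta>',A), (\<delta>',A,\<delta>), (\<delta>',\<delta>,A)}
      \<and> x $ 1 = q * a \<and> x $ 2 = q * b \<and> x $ 3 = q * c"
    using z(2) by blast
  then obtain a b c where abc: "(a, b, c) \<in> {(A,\<delta>,\<delta>'), (A,\<delta>',\<delta>), (\<delta>,A,\<delta>'), (\<delta>,\<delta>',A), (\<delta>',A,\<delta>), (\<delta>',\<delta>,A)}"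
      and x: "x $ 1 = q * a" "x $ 2 = q * b" "x $ 3 = q * c" by blast
  have x5: "x $ 5 = q * 1" unfolding q_def by simp
  have p: "q \<noteq> 0" "proj x = proj (vec5 a b c B 1)"
    using proj_eq_scaled_vec5[OF assms(2) x z(1) x5] .
  show "proj x \<in> {pt_P, pt_P'} \<union> pts_145_245"
    using abc unfolding p(2) pt_P_def pt_P'_def pts_145_245_def by auto
  show "vand3 (x $ 1) (x $ 2) (x $ 3) \<noteq> 0"
    unfolding x vand3_scale using p(1) abc delta_distinct A_distinct by (auto simp: vand3_def)
qed

lemma points_forms:
  "P_line_form (vec5 a b c B 1) = 0" "tangent_form (vec5 a b A B 1) = 0" "tangent_form (vec5 1 1 \<alpha> \<beta> \<gamma>) = 0"
  unfolding P_line_form_def tangent_form_def \<kappa>_def by (simp, simp_all add: algebra_simps)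

lemma tangent_mult_nonzero: "proj x \<in> {pt_W, pt_P, pt_P'} \<Longrightarrow> tangent_form x = 0"
  unfolding pt_W_def pt_P_def pt_P'_def proj_eq_iff by (auto simp: proj_eq_iff forms_scale points_forms)

lemma P_line_mult_nonzero: "proj x \<in> {pt_P, pt_P'} \<union> pts_145_245 \<Longrightarrow> P_line_form x = 0"
  unfolding pt_P_def pt_P'_def pts_145_245_def by (auto simp: proj_eq_iff forms_scale points_forms)

lemma points_distinct:
  "pt_W \<noteq> pt_P" "pt_W \<noteq> pt_P'" "pt_P \<noteq> pt_P'" "pt_W \<notin> pts_145_245" "pt_P \<notin> pts_145_245" "pt_P' \<notin> pts_145_245"
  "distinct [proj (vec5 A \<delta>' \<delta> B 1), proj (vec5 A \<delta> \<delta>' B 1), proj (vec5 \<delta>' A \<delta> B 1), proj (vec5 \<delta> A \<delta>' B 1)]"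
  using delta_distinct A_distinct 
  unfolding pt_W_def pt_P_def pt_P'_def pts_145_245_def
  by (auto simp: proj_vec5_eq_1 dest: proj_vec5_neq[THEN notE, rotated] simp: eq_commute[of "proj (vec5 1 1 \<alpha> \<beta> \<gamma>)"])

lemma points_on_curve: "pt_W \<in> bring_curve" "pt_P \<in> bring_curve" "pt_P' \<in> bring_curve" "pts_145_245 \<subseteq> bring_curve"
proof -
  have "\<gamma> \<noteq> 0" using e_W(3) by auto
  then show "pt_W \<in> bring_curve" unfolding pt_W_def by (intro vec5_on_curve bring_eqs_W)
  have "proj (vec5 a b c B 1) \<in> bring_curve" 
    if "(a, b, c) \<in> {(A,\<delta>,\<delta>'), (A,\<delta>',\<delta>), (\<delta>,A,\<delta>'), (\<delta>,\<delta>',A), (\<delta>',A,\<delta>), (\<delta>',\<delta>,A)}" for a b c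
  proof (rule vec5_on_curve)
    show "bring_eqs a b c B 1" using bring_eqs_P that unfolding bring_eqs_def by (auto simp: algebra_simps)
  qed simp
  then show "pt_P \<in> bring_curve" "pt_P' \<in> bring_curve" "pts_145_245 \<subseteq> bring_curve"
    unfolding pt_P_def pt_P'_def pts_145_245_def by auto
qed

end

section \<open>Orders of the linear forms along the curve\<close>

context bring_lift begin

lemma nhds_nonzero:
  assumes "f analytic_on {t}" "f t \<noteq> (0::complex)"
  shows "\<forall>\<^sub>F s in nhds t. f s \<noteq> 0"
  using analytic_at_neq_imp_eventually_neq[OF assms] assms(2) by (simp add: eventually_nhds_conv_at)

lemma nhds_in_S: "t \<in> S \<Longrightarrow> \<forall>\<^sub>F s in nhds t. s \<in> S"
  using open_S by (rule eventually_nhds_in_open)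

end

text \<open>The local equations at \<open>W\<^bsub>345\<^esub>\<close>: \<open>l\<close> is a unit times \<open>m\<^sup>2\<close> by the cubic, and \<open>m\<close> is a unit times
  \<open>h\<^sup>2\<close> by the branch conic.\<close>

lemma fourth_power_solution:
  fixes k K :: complex
  assumes L: "L * G = k * N * M^2" and h: "K * h^2 = M * U + L * H" and G: "G \<noteq> 0"
    and u: "u = U + k * N * M * H / G" "u \<noteq> 0"
  shows "L = (h * h) * (h * h) * (k * N * K^2 / (u^2 * G))"
proof -
  have "u * G = U * G + k * N * M * H" using u(1) G by (simp add: distrib_right)
  then have "G * (M * u) = G * (K * h^2)" using L h by algebra
  then have "M * u = K * h^2" using G by simp
  then have "L * (u^2 * G) = (h * h) * (h * h) * (k * N * K^2)" using L by algebra
  then show ?thesis using G u(2) by (simp add: eq_divide_eq)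
qed

locale bring_lift_constants = bring_constants + bring_lift
begin

lemma forms_analytic:
  assumes "t \<in> S"
  shows "(\<lambda>t. tangent_form (w t)) analytic_on {t}" "(\<lambda>t. P_line_form (w t)) analytic_on {t}"
    "(\<lambda>t. W_line_form (w t)) analytic_on {t}" "(\<lambda>t. conic_form (w t)) analytic_on {t}"
    "(\<lambda>t. residual_line (P_line_form (w t)) (W_line_form (w t)) (tangent_form (w t))) analytic_on {t}"
  unfolding tangent_form_def P_line_form_def W_line_form_def conic_form_def residual_conic_def residual_line_def plane_cubic_dx_def
  using analytic[OF assms] by (intro analytic_intros; simp)+

lemma P_line_form_deriv: 
  assumes "t \<in> S"
  shows "((\<lambda>t. P_line_form (w t)) has_field_derivative P_line_form (w' t)) (at t)"
  unfolding P_line_form_def w'_def using has_deriv[OF assms] by (auto intro!: derivative_eq_intros)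

text \<open>A multiple zero would give \<open>w\<^sub>4 w\<^sub>5' = w\<^sub>5 w\<^sub>4'\<close>, although the first three coordinates are distinct.\<close>

lemma P_line_form_simple_zero:
  assumes "t \<in> S" "P_line_form (w t) = 0"
  shows "P_line_form (w' t) \<noteq> 0"
proof
  assume "P_line_form (w' t) = 0"
  then have "minor w 4 5 t = 0" using assms(2) unfolding minor_w' P_line_form_def by simp
  moreover have "vand3 (w t $ 1) (w t $ 2) (w t $ 3) \<noteq> 0"
    using P_line_form_zero(2) on_curve[OF assms(1)] nonzero[OF assms(1)] assms(2) by blast
  ultimately show False using minor_nonzero[OF assms(1), of 4 5 1 2 3] by simp
qed

lemma P_line_order:
  assumes "t \<in> S"
  shows "local_order (\<lambda>t. P_line_form (w t)) t (P_line_mult (proj (w t)))"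
proof (cases "P_line_form (w t) = 0")
  case True
  then have "P_line_mult (proj (w t)) = 1"
    using P_line_form_zero(1) on_curve[OF assms] nonzero[OF assms] unfolding P_line_mult_def by simp
  moreover have "local_order (\<lambda>t. P_line_form (w t)) t 1"
    using P_line_form_simple_zero[OF assms True] DERIV_imp_deriv[OF P_line_form_deriv[OF assms]] True
    by (intro local_order_simple_zero forms_analytic assms) simp_all
  ultimately show ?thesis by simp
next
  case False
  then have "P_line_mult (proj (w t)) = 0" using P_line_mult_nonzero unfolding P_line_mult_def by auto
  then show ?thesis using local_order_unit[OF forms_analytic(2)[OF assms]] False by simp
qed

text \<open>At \<open>P\<^bsub>345\<^esub>\<close> and \<open>P'\<^bsub>345\<^esub>\<close>: on the curve \<open>l\<close> times the residual conic equals \<open>n m\<^sup>2\<close> up to a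
  constant, where \<open>m\<close> is a unit and \<open>n\<close> has a simple zero. Differentiating, \<open>l' \<noteq> 0\<close>.\<close>

lemma tangent_order_transversal:
  assumes t: "t \<in> S" and z: "tangent_form (w t) = 0" "P_line_form (w t) = 0" "W_line_form (w t) \<noteq> 0"
  shows "local_order (\<lambda>t. tangent_form (w t)) t 1"
proof (rule local_order_simple_zero[OF forms_analytic(1)[OF t] z(1)])
  let ?l = "\<lambda>t. tangent_form (w t)" and ?n = "\<lambda>t. P_line_form (w t)"
  let ?g = "\<lambda>t. conic_form (w t)" and ?m = "\<lambda>t. (25/4) * \<sigma>^2 * (W_line_form (w t))^2"
  have D: "(f has_field_derivative deriv f t) (at t)" if "f analytic_on {t}" for f :: "complex \<Rightarrow> complex"
    using that by (simp add: analytic_on_imp_differentiable_at DERIV_deriv_iff_field_differentiable)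
  have m: "?m analytic_on {t}" using forms_analytic(3)[OF t] by (intro analytic_intros)
  have "((\<lambda>t. ?l t * ?g t) has_field_derivative deriv ?l t * ?g t + deriv ?g t * ?l t) (at t)"
    by (intro DERIV_mult D forms_analytic t)
  moreover have "\<forall>\<^sub>F s in nhds t. ?l s * ?g s = ?n s * ?m s"
    using nhds_in_S[OF t] by eventually_elim (use curve_identities(1)[OF on_curve] in \<open>simp add: mult_ac\<close>)
  ultimately have "((\<lambda>t. ?n t * ?m t) has_field_derivative deriv ?l t * ?g t + deriv ?g t * ?l t) (at t)"
    by (subst (asm) has_field_derivative_cong_eventually[where g = "\<lambda>t. ?n t * ?m t"]) (auto simp: eventually_nhds_conv_at)
  moreover have "((\<lambda>t. ?n t * ?m t) has_field_derivative P_line_form (w' t) * ?m t + deriv ?m t * ?n t) (at t)"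
    by (intro DERIV_mult P_line_form_deriv D m t)
  ultimately have "deriv ?l t * ?g t + deriv ?g t * ?l t = P_line_form (w' t) * ?m t + deriv ?m t * ?n t"
    by (rule DERIV_unique)
  moreover have "P_line_form (w' t) * ?m t \<noteq> 0"
    using P_line_form_simple_zero[OF t z(2)] z(3) sigma_nonzero by simp
  ultimately show "deriv ?l t \<noteq> 0" using z by auto
qed

text \<open>At \<open>W\<^bsub>345\<^esub>\<close> the difference \<open>h\<close> of the first two coordinates is a local parameter, and \<open>l\<close> is a unit
  times \<open>h\<^sup>4\<close>.\<close>

lemma tangent_order_W:
  assumes t: "t \<in> S" and z: "tangent_form (w t) = 0" "W_line_form (w t) = 0" "P_line_form (w t) \<noteq> 0" "conic_form (w t) \<noteq> 0"
    "w t $ 1 = w t $ 2" "w t $ 1 \<noteq> 0" "vand3 (w t $ 3) (w t $ 4) (w t $ 5) \<noteq> 0"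
  shows "local_order (\<lambda>t. tangent_form (w t)) t 4"
proof -
  define h where "h s = w s $ 1 - w s $ 2" for s
  define L where "L s = tangent_form (w s)" for s
  define N where "N s = P_line_form (w s)" for s
  define M where "M s = W_line_form (w s)" for s
  define G where "G s = conic_form (w s)" for s
  define H where "H s = residual_line (N s) (M s) (L s)" for s
  \<comment> \<open>The units of the two local equations: \<open>\<kappa>\<^sup>2 h\<^sup>2 = M u\<close> and \<open>L = h\<^sup>4 v\<close>.\<close>
  define u where "u s = - 10 * \<sigma> * N s - (15/8) * \<sigma>^2 * M s + (25/4) * \<sigma>^2 * N s * M s * H s / G s" for s
  define v where "v s = (25/4) * \<sigma>^2 * N s * (\<kappa>^2)^2 / ((u s)^2 * G s)" for s
  have an: "L analytic_on {t}" "N analytic_on {t}" "M analytic_on {t}" "G analytic_on {t}" "H analytic_on {t}"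
    using forms_analytic[OF t] unfolding L_def N_def M_def G_def H_def .
  have G0: "G t \<noteq> 0" using z unfolding G_def by simp
  have ua: "u analytic_on {t}"
    unfolding u_def[abs_def] using an G0 by (intro analytic_intros) auto
  have u0: "u t \<noteq> 0" using z sigma_nonzero unfolding u_def N_def M_def by simp
  have v: "v analytic_on {t}" "v t \<noteq> 0"
    using ua an G0 u0 z sigma_nonzero kappa_nonzero unfolding v_def[abs_def] N_def by (auto intro!: analytic_intros)
  have h: "local_order h t 1"
  proof (rule local_order_simple_zero)
    show "h analytic_on {t}" unfolding h_def[abs_def] by (intro analytic_intros analytic t)
    show "h t = 0" using z unfolding h_def by simp
    have "(h has_field_derivative w' t $ 1 - w' t $ 2) (at t)"
      unfolding h_def[abs_def] w'_def using has_deriv[OF t] by (auto intro!: derivative_eq_intros)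
    then have "deriv h t = w' t $ 1 - w' t $ 2" by (rule DERIV_imp_deriv)
    moreover have "minor w 1 2 t \<noteq> 0" using minor_nonzero[OF t, of 1 2 3 4 5] z by simp
    ultimately show "deriv h t \<noteq> 0" using z unfolding minor_w' by auto
  qed
  have o: "local_order (\<lambda>s. (h s * h s) * (h s * h s) * v s) t (1 + 1 + (1 + 1) + 0)"
    by (intro local_order_mult h local_order_unit v)
  have "\<forall>\<^sub>F s in nhds t. tangent_form (w s) = (h s * h s) * (h s * h s) * v s"
    using nhds_in_S[OF t] nhds_nonzero[OF an(4) G0] nhds_nonzero[OF ua u0]
  proof eventually_elim
    case (elim s)
    have 1: "L s * G s = (25/4) * \<sigma>^2 * N s * (M s)^2"
      using curve_identities(1)[OF on_curve[OF elim(1)]] unfolding L_def N_def M_def G_def .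
    have 2: "\<kappa>^2 * (h s)^2 = M s * (- 10 * \<sigma> * N s - (15/8) * \<sigma>^2 * M s) + L s * H s"
      using curve_identities(2)[OF on_curve[OF elim(1)]] unfolding L_def N_def M_def H_def h_def .
    have "L s = (h s * h s) * (h s * h s) * v s"
      unfolding v_def by (rule fourth_power_solution[OF 1 2 elim(2) u_def elim(3)])
    then show ?case unfolding L_def .
  qed
  then have "\<forall>\<^sub>F s in at t. tangent_form (w s) = (h s * h s) * (h s * h s) * v s"
    unfolding eventually_nhds_conv_at by blast
  from local_order_cong[OF o this] show ?thesis by simp
qed

lemma tangent_order:
  assumes "t \<in> S"
  shows "local_order (\<lambda>t. tangent_form (w t)) t (tangent_mult (proj (w t)))"
proof (cases "tangent_form (w t) = 0")
  case True
  from tangent_form_zero[OF on_curve[OF assms] nonzero[OF assms] True] show ?thesis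
  proof (elim disjE conjE)
    assume "proj (w t) = pt_W"
    then have "tangent_mult (proj (w t)) = 4" unfolding tangent_mult_def by simp
    moreover assume "W_line_form (w t) = 0" "P_line_form (w t) \<noteq> 0" "w t $ 1 = w t $ 2" "w t $ 1 \<noteq> 0"
      "conic_form (w t) \<noteq> 0" "vand3 (w t $ 3) (w t $ 4) (w t $ 5) \<noteq> 0"
    then have "local_order (\<lambda>t. tangent_form (w t)) t 4" using tangent_order_W[OF assms True] by blast
    ultimately show ?thesis by simp
  next
    assume "proj (w t) \<in> {pt_P, pt_P'}"
    then have "tangent_mult (proj (w t)) = 1" using points_distinct(1,2) unfolding tangent_mult_def by auto
    moreover assume "P_line_form (w t) = 0" "W_line_form (w t) \<noteq> 0"
    then have "local_order (\<lambda>t. tangent_form (w t)) t 1" using tangent_order_transversal[OF assms True] by blast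
    ultimately show ?thesis by simp
  qed
next
  case False
  then have "tangent_mult (proj (w t)) = 0" using tangent_mult_nonzero unfolding tangent_mult_def by auto
  then show ?thesis using local_order_unit[OF forms_analytic(1)[OF assms]] False by simp
qed

end

section \<open>Residue differentials and their divisors\<close>

definition chosen_lift :: "(complex ^ 5) set chart \<Rightarrow> complex \<Rightarrow> complex ^ 5" where
  "chosen_lift c = (SOME w. bring_lift (chart_range c) w \<and> (\<forall>t\<in>chart_range c. chart_inv c t = proj (w t)))"

lemma chosen_lift:
  assumes "c \<in> curve_atlas bring_curve"
  shows "bring_lift (chart_range c) (chosen_lift c)" "t \<in> chart_range c \<Longrightarrow> chart_inv c t = proj (chosen_lift c t)"
proof -
  have *: "bring_lift (chart_range c) (chosen_lift c) \<and> (\<forall>t\<in>chart_range c. chart_inv c t = proj (chosen_lift c t))"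
    unfolding chosen_lift_def by (rule someI_ex[OF atlas_lift[OF assms]])
  show "bring_lift (chart_range c) (chosen_lift c)" by (rule conjunct1[OF *])
  show "t \<in> chart_range c \<Longrightarrow> chart_inv c t = proj (chosen_lift c t)" by (rule bspec[OF conjunct2[OF *]])
qed

lemma chart_inv_at: "c \<in> curve_atlas X \<Longrightarrow> p \<in> fst c \<Longrightarrow> chart_inv c (snd c p) = p"
  by (rule inv_into_f_f[OF atlas_inj])

text \<open>The Poincare residue attached to a linear form \<open>\<Lambda>\<close>.\<close>

definition residue_form :: "(complex ^ 5 \<Rightarrow> complex) \<Rightarrow> (complex ^ 5) set chart \<Rightarrow> complex \<Rightarrow> complex" where
  "residue_form \<Lambda> c t = \<Lambda> (chosen_lift c t) * residue_factor (chosen_lift c) t"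

text \<open>Under a change of lift by the scalar \<open>q\<close>, \<open>\<Lambda>\<close> scales with \<open>q\<close> and the residue factor with \<open>1 / q\<close>,
  up to the derivative of the change of coordinates.\<close>

lemma residue_form_holomorphic_differential:
  assumes scale: "\<And>q x. \<Lambda> (q *s x) = q * \<Lambda> x"
    and form_analytic: "\<And>S w t. bring_lift S w \<Longrightarrow> t \<in> S \<Longrightarrow> (\<lambda>t. \<Lambda> (w t)) analytic_on {t}"
  shows "holomorphic_differential (curve_atlas bring_curve) (residue_form \<Lambda>)"
  unfolding holomorphic_differential_def
proof (intro conjI ballI)
  fix c assume c: "c \<in> curve_atlas bring_curve"
  interpret bring_lift "chart_range c" "chosen_lift c" by (rule chosen_lift(1)[OF c])
  have "residue_form \<Lambda> c analytic_on {t}" if "t \<in> chart_range c" for t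
    unfolding residue_form_def[abs_def]
    by (intro analytic_on_mult form_analytic[OF bring_lift_axioms that] residue_factor_analytic[OF that])
  then show "residue_form \<Lambda> c holomorphic_on chart_range c"
    using analytic_on_analytic_at analytic_imp_holomorphic by blast
next
  fix c d p
  assume c: "c \<in> curve_atlas bring_curve" and d: "d \<in> curve_atlas bring_curve" and p: "p \<in> fst c \<inter> fst d"
  define s where "s = snd d \<circ> chart_inv c"
  define t0 where "t0 = snd c p"
  have t0: "t0 \<in> chart_range c" and s0: "s t0 = snd d p" "s t0 \<in> chart_range d"
    using p chart_inv_at[OF c, of p] unfolding t0_def s_def by auto
  have s: "isCont s t0" and near: "\<forall>\<^sub>F t in nhds t0. t \<in> chart_range c \<and> chart_inv c t \<in> fst d"
    using transition_continuous[OF c d, of p] p unfolding s_def t0_def by auto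
  have eq: "\<forall>\<^sub>F t in nhds t0. \<exists>q. q \<noteq> 0 \<and> chosen_lift c t = q *s chosen_lift d (s t)"
    using near
  proof eventually_elim
    case (elim t)
    have "proj (chosen_lift c t) = chart_inv c t" using chosen_lift(2)[OF c] elim by simp
    also have "\<dots> = chart_inv d (s t)" using chart_inv_at[OF d, of "chart_inv c t"] elim unfolding s_def by simp
    also have "\<dots> = proj (chosen_lift d (s t))" using chosen_lift(2)[OF d] elim unfolding s_def by simp
    finally show ?case unfolding proj_eq_iff .
  qed
  then obtain q where q: "q \<noteq> 0" "chosen_lift c t0 = q *s chosen_lift d (s t0)"
    using eventually_nhds_x_imp_x by blast
  have "q * residue_factor (chosen_lift c) t0 = deriv s t0 * residue_factor (chosen_lift d) (s t0)"
    using residue_factor_transition[OF chosen_lift(1)[OF c] chosen_lift(1)[OF d] t0 s0(2) s eq q(2,1)] .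
  then show "residue_form \<Lambda> c (snd c p) = residue_form \<Lambda> d (snd d p) * deriv (snd d \<circ> chart_inv c) (snd c p)"
    unfolding residue_form_def t0_def[symmetric] s_def[symmetric] s0(1)[symmetric] q(2) scale
    by (simp add: mult_ac)
qed

lemma has_divisor_bring_curveI:
  assumes keys: "\<And>p. p \<notin> bring_curve \<Longrightarrow> Poly_Mapping.lookup D p = 0"
    and order: "\<And>c t. c \<in> curve_atlas bring_curve \<Longrightarrow> t \<in> chart_range c \<Longrightarrow>
      local_order (g c) t (Poly_Mapping.lookup D (chart_inv c t))"
  shows "has_divisor bring_curve (curve_atlas bring_curve) g D"
  unfolding has_divisor_def
proof (intro conjI ballI impI)
  show "Poly_Mapping.keys D \<subseteq> bring_curve" using keys by (auto simp: in_keys_iff)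
  fix p assume p: "p \<in> bring_curve"
  show "\<exists>c\<in>curve_atlas bring_curve. p \<in> fst c" using bring_curve_chart_exists[OF p] .
  fix c assume c: "c \<in> curve_atlas bring_curve" "p \<in> fst c"
  have o: "local_order (g c) (snd c p) (Poly_Mapping.lookup D p)"
    using order[OF c(1), of "snd c p"] c chart_inv_at[OF c] by simp
  show "\<exists>\<^sub>F t in at (snd c p). g c t \<noteq> 0"
    using local_order_eventually_nonzero[OF o] by (simp add: eventually_frequently)
  show "zorder (g c) (snd c p) = Poly_Mapping.lookup D p" using local_order_zorder[OF o] .
qed

section \<open>The meromorphic function and the theorem\<close>

context bring_constants begin

text \<open>The quotient \<open>n / l\<close> has the indeterminate form 0/0 at \<open>P\<^bsub>345\<^esub>\<close> and \<open>P'\<^bsub>345\<^esub>\<close>. There the relation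
  \<open>l G = (25/4) \<sigma>\<^sup>2 n m\<^sup>2\<close> turns it into the second expression, with denominator \<open>m\<^sup>2\<close>, which is
  finite at these points. At the pole \<open>W\<^bsub>345\<^esub>\<close> both \<open>l\<close> and \<open>m\<close> vanish, so the value is 0.\<close>

definition bring_function :: "(complex ^ 5) set \<Rightarrow> complex" where
  "bring_function p = (let x = representative p in
     if tangent_form x \<noteq> 0 then P_line_form x / tangent_form x
     else 4 * conic_form x / (25 * \<sigma>^2 * (W_line_form x)^2))"

lemma bring_function_proj:
  "bring_function (proj x) = (if tangent_form x \<noteq> 0 then P_line_form x / tangent_form x
     else 4 * conic_form x / (25 * \<sigma>^2 * (W_line_form x)^2))"
proof -
  obtain c where "c \<noteq> 0" "representative (proj x) = c *s x" by (rule representative_proj)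
  then show ?thesis
    unfolding bring_function_def Let_def by (simp add: forms_scale conic_scale power_mult_distrib mult_ac)
qed

lemma bring_function_aux:
  assumes "bring_vec x" "W_line_form x \<noteq> 0"
  shows "bring_function (proj x) = 4 * conic_form x / (25 * \<sigma>^2 * (W_line_form x)^2)"
  unfolding bring_function_proj using curve_identities(1)[OF assms(1)] assms(2) sigma_nonzero
  by (auto simp: field_simps)

text \<open>Outside of the isolated zeros of \<open>l\<close> the function is \<open>n / l\<close>, which gives its order. Its value is
  the limit at all points except \<open>W\<^bsub>345\<^esub>\<close>, because one of the two expressions defines it in a
  whole neighbourhood.\<close>

lemma bring_function_near:
  assumes c: "c \<in> curve_atlas bring_curve" and t: "t \<in> chart_range c"
  shows "local_order (bring_function \<circ> chart_inv c) t (P_line_mult (chart_inv c t) - tangent_mult (chart_inv c t))"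
    "(is_pole (bring_function \<circ> chart_inv c) t \<and> (bring_function \<circ> chart_inv c) t = 0)
      \<or> (bring_function \<circ> chart_inv c) \<midarrow>t\<rightarrow> (bring_function \<circ> chart_inv c) t"
proof -
  let ?w = "chosen_lift c" and ?g = "bring_function \<circ> chart_inv c"
  interpret bring_lift "chart_range c" ?w by (rule chosen_lift(1)[OF c])
  interpret bring_lift_constants \<alpha> \<beta> \<gamma> A B \<delta> \<delta>' "chart_range c" ?w ..
  have g: "?g s = bring_function (proj (?w s))" if "s \<in> chart_range c" for s
    using chosen_lift(2)[OF c that] by simp
  have p: "chart_inv c t = proj (?w t)" using chosen_lift(2)[OF c t] .
  have "\<forall>\<^sub>F s in at t. tangent_form (?w s) \<noteq> 0"
    using local_order_eventually_nonzero[OF tangent_order[OF t]] .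
  moreover have "\<forall>\<^sub>F s in at t. s \<in> chart_range c" using nhds_in_S[OF t] by (simp add: eventually_nhds_conv_at)
  ultimately have "\<forall>\<^sub>F s in at t. ?g s = P_line_form (?w s) / tangent_form (?w s)"
    by eventually_elim (simp add: g bring_function_proj del: comp_apply)
  then show o: "local_order ?g t (P_line_mult (chart_inv c t) - tangent_mult (chart_inv c t))"
    unfolding p by (rule local_order_cong[OF local_order_divide[OF P_line_order[OF t] tangent_order[OF t]]])
  have lim: "?g \<midarrow>t\<rightarrow> ?g t" if "f analytic_on {t}" "\<forall>\<^sub>F s in nhds t. ?g s = f s" for f
  proof -
    have "?g analytic_on {t}" using that(1) analytic_at_cong[OF that(2) refl] by blast
    then show ?thesis using analytic_at_imp_isCont unfolding isCont_def by blast
  qed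
  consider "tangent_form (?w t) \<noteq> 0" | "W_line_form (?w t) \<noteq> 0" | "tangent_form (?w t) = 0" "W_line_form (?w t) = 0" by blast
  then show "(is_pole ?g t \<and> ?g t = 0) \<or> ?g \<midarrow>t\<rightarrow> ?g t"
  proof cases
    case 1
    have "\<forall>\<^sub>F s in nhds t. ?g s = P_line_form (?w s) / tangent_form (?w s)"
      using nhds_in_S[OF t] nhds_nonzero[OF forms_analytic(1)[OF t] 1]
      by eventually_elim (simp add: g bring_function_proj del: comp_apply)
    then show ?thesis using lim 1 forms_analytic[OF t] by (intro disjI2) (auto intro!: lim analytic_intros)
  next
    case 2
    have "\<forall>\<^sub>F s in nhds t. ?g s = 4 * conic_form (?w s) / (25 * \<sigma>^2 * (W_line_form (?w s))^2)"
      using nhds_in_S[OF t] nhds_nonzero[OF forms_analytic(3)[OF t] 2]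
      by eventually_elim (simp add: g bring_function_aux on_curve del: comp_apply)
    moreover have "(\<lambda>s. 4 * conic_form (?w s) / (25 * \<sigma>^2 * (W_line_form (?w s))^2)) analytic_on {t}"
      using 2 sigma_nonzero forms_analytic[OF t] by (intro analytic_intros) auto
    ultimately show ?thesis using lim by blast
  next
    case 3
    have "proj (?w t) = pt_W" using tangent_form_zero[OF on_curve[OF t] nonzero[OF t] 3(1)] 3(2) by auto
    then have "P_line_mult (chart_inv c t) - tangent_mult (chart_inv c t) = - 4"
      using points_distinct unfolding p P_line_mult_def tangent_mult_def by simp
    then have "is_pole ?g t" using local_order_pole[OF o] by simp
    moreover have "?g t = 0" unfolding g[OF t] bring_function_proj using 3 by simp
    ultimately show ?thesis by blast
  qed
qed

lemma bring_function_meromorphic: "meromorphic_function (curve_atlas bring_curve) bring_function"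
  unfolding meromorphic_function_def nicely_meromorphic_on_def
proof (intro ballI conjI)
  fix c assume c: "c \<in> curve_atlas bring_curve"
  show "bring_function \<circ> chart_inv c meromorphic_on chart_range c"
    unfolding meromorphic_on_meromorphic_at[of _ "chart_range c"]
  proof
    fix t assume "t \<in> chart_range c"
    from local_order_meromorphic[OF bring_function_near(1)[OF c this]]
    show "bring_function \<circ> chart_inv c meromorphic_on {t}" .
  qed
  fix t assume "t \<in> chart_range c"
  from bring_function_near(2)[OF c this]
  show "is_pole (bring_function \<circ> chart_inv c) t \<and> (bring_function \<circ> chart_inv c) t = 0
      \<or> (bring_function \<circ> chart_inv c) \<midarrow>t\<rightarrow> (bring_function \<circ> chart_inv c) t" .
qed

lemma tangent_differential:
  "holomorphic_differential (curve_atlas bring_curve) (residue_form tangent_form)"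
  "has_divisor bring_curve (curve_atlas bring_curve) (residue_form tangent_form)
     (frag_cmul 4 (frag_of pt_W) + frag_of pt_P + frag_of pt_P')" (is "has_divisor _ _ _ ?D")
proof -
  have lift: "bring_lift_constants \<alpha> \<beta> \<gamma> A B \<delta> \<delta>' S w" if "bring_lift S w" for S w
    by (rule bring_lift_constants.intro[OF bring_constants_axioms that])
  show "holomorphic_differential (curve_atlas bring_curve) (residue_form tangent_form)"
    by (rule residue_form_holomorphic_differential)
      (simp_all add: forms_scale bring_lift_constants.forms_analytic[OF lift])
  have D: "Poly_Mapping.lookup ?D p = tangent_mult p" for p
    using points_distinct unfolding tangent_mult_def by (auto simp: lookup_add)
  show "has_divisor bring_curve (curve_atlas bring_curve) (residue_form tangent_form) ?D"
  proof (rule has_divisor_bring_curveI)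
    fix p assume "p \<notin> bring_curve"
    then show "Poly_Mapping.lookup ?D p = 0" using points_on_curve unfolding D tangent_mult_def by auto
  next
    fix c t assume c: "c \<in> curve_atlas bring_curve" and t: "t \<in> chart_range c"
    interpret bring_lift "chart_range c" "chosen_lift c" by (rule chosen_lift(1)[OF c])
    interpret bring_lift_constants \<alpha> \<beta> \<gamma> A B \<delta> \<delta>' "chart_range c" "chosen_lift c" ..
    have "local_order (\<lambda>t. tangent_form (chosen_lift c t) * residue_factor (chosen_lift c) t) t
       (tangent_mult (proj (chosen_lift c t)) + 0)"
      by (intro local_order_mult tangent_order local_order_unit residue_factor_analytic residue_factor_nonzero t)
    then show "local_order (residue_form tangent_form c) t (Poly_Mapping.lookup ?D (chart_inv c t))"
      unfolding D chosen_lift(2)[OF c t] residue_form_def[abs_def] by simp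
  qed
qed

lemma bring_function_divisor:
  assumes "pts_145_245 = {p1, p2, p3, p4}" "distinct [p1, p2, p3, p4]"
  shows "function_has_divisor bring_curve (curve_atlas bring_curve) bring_function
     (frag_of p1 + frag_of p2 + frag_of p3 + frag_of p4 - frag_cmul 4 (frag_of pt_W))" 
    (is "function_has_divisor _ _ _ ?D")
proof -
  have D: "Poly_Mapping.lookup ?D p = P_line_mult p - tangent_mult p" for p
  proof -
    have l: "Poly_Mapping.lookup ?D p = (if p = p1 then 1 else 0) + (if p = p2 then 1 else 0)
        + (if p = p3 then 1 else 0) + (if p = p4 then 1 else 0) - 4 * (if p = pt_W then 1 else 0)"
      by (simp add: lookup_add lookup_minus eq_commute[of p])
    have W: "pt_W \<noteq> p1" "pt_W \<noteq> p2" "pt_W \<noteq> p3" "pt_W \<noteq> p4"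
      using points_distinct(4) unfolding assms(1) by auto
    have ne: "p1 \<noteq> p2" "p1 \<noteq> p3" "p1 \<noteq> p4" "p2 \<noteq> p1" "p2 \<noteq> p3" "p2 \<noteq> p4" "p3 \<noteq> p1" "p3 \<noteq> p2" "p3 \<noteq> p4" "p4 \<noteq> p1" "p4 \<noteq> p2" "p4 \<noteq> p3"
      using assms(2) by auto
    have other: "p \<noteq> pt_W" "p \<noteq> pt_P" "p \<noteq> pt_P'" if "p \<in> pts_145_245"
      using that points_distinct(4-6) by auto
    consider "p = pt_W" | "p = pt_P \<or> p = pt_P'" | "p = p1" | "p = p2" | "p = p3" | "p = p4"
      | "p \<notin> pts_145_245" "p \<noteq> pt_W" "p \<noteq> pt_P" "p \<noteq> pt_P'"
      unfolding assms(1) by blast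
    then show ?thesis
    proof cases
      case 1
      then show ?thesis unfolding l tangent_mult_def P_line_mult_def using W points_distinct(1,2,4) by simp
    next
      case 2
      then have "p \<noteq> pt_W" "p \<notin> pts_145_245" using points_distinct(1,2,5,6) by metis+
      then show ?thesis using 2 unfolding l tangent_mult_def P_line_mult_def assms(1) by simp
    next
      case 7
      then show ?thesis unfolding l tangent_mult_def P_line_mult_def assms(1) by simp
    qed (unfold l tangent_mult_def P_line_mult_def, use ne other in \<open>simp_all add: assms(1)\<close>)
  qed
  show ?thesis
    unfolding function_has_divisor_def
  proof (rule has_divisor_bring_curveI)
    fix p assume "p \<notin> bring_curve"
    then show "Poly_Mapping.lookup ?D p = 0" using points_on_curve unfolding D tangent_mult_def P_line_mult_def by auto
  next
    fix c t assume c: "c \<in> curve_atlas bring_curve" and t: "t \<in> chart_range c"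
    show "local_order (bring_function \<circ> chart_inv c) t (Poly_Mapping.lookup ?D (chart_inv c t))"
      using bring_function_near(1)[OF c t] unfolding D .
  qed
qed

lemma bring_points:
  "bring_W \<alpha> \<beta> \<gamma> 3 4 5 = pt_W" "bring_P A B \<delta> \<delta>' 3 4 5 1 = pt_P" "bring_P A B \<delta> \<delta>' 3 4 5 2 = pt_P'"
  "pts_145_245 = {bring_P A B \<delta> \<delta>' 1 4 5 2, bring_P A B \<delta> \<delta>' 1 4 5 3, bring_P A B \<delta> \<delta>' 2 4 5 1, bring_P A B \<delta> \<delta>' 2 4 5 3}"
  "distinct [bring_P A B \<delta> \<delta>' 1 4 5 2, bring_P A B \<delta> \<delta>' 1 4 5 3, bring_P A B \<delta> \<delta>' 2 4 5 1, bring_P A B \<delta> \<delta>' 2 4 5 3]"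
proof -
  have W: "bring_W \<alpha> \<beta> \<gamma> 3 4 5 = proj (vec5 1 1 \<alpha> \<beta> \<gamma>)"
    unfolding bring_W_def by (intro arg_cong[of _ _ proj] vec5_eqI) simp_all
  have P: "bring_P A B \<delta> \<delta>' 3 4 5 1 = proj (vec5 \<delta>' \<delta> A B 1)" "bring_P A B \<delta> \<delta>' 3 4 5 2 = proj (vec5 \<delta> \<delta>' A B 1)"
    "bring_P A B \<delta> \<delta>' 1 4 5 2 = proj (vec5 A \<delta>' \<delta> B 1)" "bring_P A B \<delta> \<delta>' 1 4 5 3 = proj (vec5 A \<delta> \<delta>' B 1)"
    "bring_P A B \<delta> \<delta>' 2 4 5 1 = proj (vec5 \<delta>' A \<delta> B 1)" "bring_P A B \<delta> \<delta>' 2 4 5 3 = proj (vec5 \<delta> A \<delta>' B 1)"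
    unfolding bring_P_def by (intro arg_cong[of _ _ proj] vec5_eqI; simp)+
  show "bring_W \<alpha> \<beta> \<gamma> 3 4 5 = pt_W" "bring_P A B \<delta> \<delta>' 3 4 5 1 = pt_P" "bring_P A B \<delta> \<delta>' 3 4 5 2 = pt_P'"
   "pts_145_245 = {bring_P A B \<delta> \<delta>' 1 4 5 2, bring_P A B \<delta> \<delta>' 1 4 5 3, bring_P A B \<delta> \<delta>' 2 4 5 1, bring_P A B \<delta> \<delta>' 2 4 5 3}"
   "distinct [bring_P A B \<delta> \<delta>' 1 4 5 2, bring_P A B \<delta> \<delta>' 1 4 5 3, bring_P A B \<delta> \<delta>' 2 4 5 1, bring_P A B \<delta> \<delta>' 2 4 5 3]"
    using points_distinct(7) unfolding W P pt_W_def pt_P_def pt_P'_def pts_145_245_def by simp_all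
qed

end

theorem proposition3p6:
  fixes \<alpha> \<beta> \<gamma> A B \<delta> \<delta>' :: complex
  assumes "[:4, 3, 2, 1:] = [:-\<alpha>, 1:] * [:-\<beta>, 1:] * [:-\<gamma>, 1:]"
    and "A = (-43 * \<alpha>^2 - 113 * \<alpha> - 92) * \<beta> / 112 - (13 * \<alpha>^2 + 27 * \<alpha> + 20) / 28"
    and "B = (43 * \<alpha>^2 + 25 * \<alpha> - 4) * \<beta> / 112 + (13 * \<alpha>^2 + 3 * \<alpha> - 24) / 28"
    and "[: (23 * (155 * \<alpha> + 388) * \<beta> + 92 * (97 * \<alpha> + 172)) / 6272,
            - (((11 * \<alpha> + 12) * \<beta> + 4 * (3 * \<alpha> + 2)) / 14), 1 :]
         = [:-\<delta>, 1:] * [:-\<delta>', 1:]"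
  defines "W345 \<equiv> bring_W \<alpha> \<beta> \<gamma> 3 4 5"
    and "P345 \<equiv> bring_P A B \<delta> \<delta>' 3 4 5 1" and "P345' \<equiv> bring_P A B \<delta> \<delta>' 3 4 5 2"
    and "P145 \<equiv> bring_P A B \<delta> \<delta>' 1 4 5 2" and "P145' \<equiv> bring_P A B \<delta> \<delta>' 1 4 5 3"
    and "P245 \<equiv> bring_P A B \<delta> \<delta>' 2 4 5 1" and "P245' \<equiv> bring_P A B \<delta> \<delta>' 2 4 5 3"
  shows "(\<exists>\<nu>. holomorphic_differential (curve_atlas bring_curve) \<nu> \<and>
            has_divisor bring_curve (curve_atlas bring_curve) \<nu>
              (frag_cmul 4 (frag_of W345) + frag_of P345 + frag_of P345')) \<and>
         (\<exists>f. meromorphic_function (curve_atlas bring_curve) f \<and>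
            function_has_divisor bring_curve (curve_atlas bring_curve) f
              (frag_of P145 + frag_of P145' + frag_of P245 + frag_of P245'
                - frag_cmul 4 (frag_of W345)))"
proof -
  interpret bring_constants \<alpha> \<beta> \<gamma> A B \<delta> \<delta>'
    by unfold_locales (rule bring_constants_relations[OF assms(1-4)])+
  have "has_divisor bring_curve (curve_atlas bring_curve) (residue_form tangent_form)
              (frag_cmul 4 (frag_of W345) + frag_of P345 + frag_of P345')"
    using tangent_differential(2) unfolding W345_def P345_def P345'_def bring_points(1-3) .
  moreover have "function_has_divisor bring_curve (curve_atlas bring_curve) bring_function
              (frag_of P145 + frag_of P145' + frag_of P245 + frag_of P245' - frag_cmul 4 (frag_of W345))"
    using bring_function_divisor[OF bring_points(4,5)]
    unfolding P145_def P145'_def P245_def P245'_def W345_def bring_points(1) .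
  ultimately show ?thesis using tangent_differential(1) bring_function_meromorphic by blast
qed

end
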